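(* Let $T$ be a bounded normal band operator on $\ell^2$. 1. If $T_n$ is a normal truncation of $T$ on $\ell^2_n$ for each $n\ge1$ and $(\|T_n\|)_{n\ge1}$ is bounded, then $\hat T_n\to T$ strongly and $$\sigma(T)\subset\{z\in\mathbb{C}:\lim_nd(z,\sigma(T_n))=0\}.$$ 2. For any $n\ge1$ and any bounded normal truncation $T_n$ of $T$ on $\ell^{2\perp}_n$, $\sigma_e(T_n)=\sigma_e(T)$.
   Context: $\ell^2$ is the Hilbert space of square-summable complex sequences with canonical basis $(e_k)_{k\ge1}$, $\ell^2_n:=\mathrm{span}\{e_1,\dots,e_n\}$ and $\ell^{2\perp}_n$ is its orthogonal complement. A bounded operator on $\ell^2$ is a band operator if its matrix in the canonical basis is a band matrix (for some $N$, the $(i,j)$ entries vanish when $|i-j|>N$). If $T$ is a bounded operator on a Hilbert space $H$ and $Q$ is a (not necessarily orthogonal) projection on a subspace $S$ along a subspace $S'$ ($H=S\oplus S'$ algebraically), the operator $T[Q]:=QT{\upharpoonright}_S$ on $S$ is called a truncation of $T$ on $S$; it is a normal truncation if it is a normal operator on $S$. For an operator $T_n$ on a subspace $S$, $\hat T_n:=T_n\oplus0$ is the operator on $H$ equal to $T_n$ on $S$ and $0$ on $S^\perp$. $\sigma$ denotes the spectrum; $\sigma_e$ denotes the essential spectrum of a normal operator, i.e. the spectrum except the isolated eigenvalues with finite multiplicity. $d$ is the distance from a point to a set in $\mathbb{C}$. *)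

theory Defs
  imports "HOL-Analysis.Analysis"
begin

section \<open>The complex Hilbert space of square-summable sequences\<close>

text \<open>Sequences are indexed from 0, so \<open>ell2_basis k\<close> below is the vector usually written
  \<open>e\<close> with index \<open>k + 1\<close>.\<close>

typedef ell2 = "{x :: nat \<Rightarrow> complex. summable (\<lambda>k. (cmod (x k))\<^sup>2)}"
  morphisms coord Abs_ell2
  by (rule exI[of _ "\<lambda>_. 0"]) simp

setup_lifting type_definition_ell2

lemma summable_coord: "summable (\<lambda>k. (cmod (coord x k))\<^sup>2)"
  using coord[of x] by simp

lemma ell2_eq_iff: "x = y \<longleftrightarrow> (\<forall>k. coord x k = coord y k)"
  by (auto simp: coord_inject[symmetric] fun_eq_iff)

lemma summable_square_add:
  assumes "summable (\<lambda>k. (cmod (f k))\<^sup>2)" "summable (\<lambda>k. (cmod (g k))\<^sup>2)"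
  shows "summable (\<lambda>k. (cmod (f k + g k))\<^sup>2)"
proof (rule summable_comparison_test')
  show "summable (\<lambda>k. 2 * (cmod (f k))\<^sup>2 + 2 * (cmod (g k))\<^sup>2)"
    by (intro summable_add summable_mult assms)
  fix k :: nat
  have "(cmod (f k + g k))\<^sup>2 \<le> (cmod (f k) + cmod (g k))\<^sup>2"
    by (intro power_mono norm_triangle_ineq) simp
  also have "\<dots> \<le> 2 * (cmod (f k))\<^sup>2 + 2 * (cmod (g k))\<^sup>2"
    using zero_le_power2[of "cmod (f k) - cmod (g k)"] by (simp add: power2_eq_square algebra_simps)
  finally show "norm ((cmod (f k + g k))\<^sup>2) \<le> 2 * (cmod (f k))\<^sup>2 + 2 * (cmod (g k))\<^sup>2"
    by simp
qed

lemma summable_square_scale: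
  assumes "summable (\<lambda>k. (cmod (f k))\<^sup>2)"
  shows "summable (\<lambda>k. (cmod (c * f k))\<^sup>2)"
  using summable_mult[OF assms, of "(cmod c)\<^sup>2"] by (simp add: norm_mult power_mult_distrib)

lemma summable_coord_mult: "summable (\<lambda>k. coord x k * cnj (coord y k))"
proof (rule summable_comparison_test')
  show "summable (\<lambda>k. (cmod (coord x k))\<^sup>2 + (cmod (coord y k))\<^sup>2)"
    by (intro summable_add summable_coord)
  fix k :: nat
  have "0 \<le> (cmod (coord x k) - cmod (coord y k))\<^sup>2"
    by simp
  then have "2 * (cmod (coord x k) * cmod (coord y k)) \<le> (cmod (coord x k))\<^sup>2 + (cmod (coord y k))\<^sup>2"
    by (simp add: power2_diff algebra_simps)
  moreover have "0 \<le> cmod (coord x k) * cmod (coord y k)"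
    by simp
  ultimately have "cmod (coord x k) * cmod (coord y k) \<le> (cmod (coord x k))\<^sup>2 + (cmod (coord y k))\<^sup>2"
    by linarith
  then show "norm (coord x k * cnj (coord y k)) \<le> (cmod (coord x k))\<^sup>2 + (cmod (coord y k))\<^sup>2"
    by (simp add: norm_mult)
qed

lift_definition scaleC :: "complex \<Rightarrow> ell2 \<Rightarrow> ell2"  (infixr \<open>*\<^sub>C\<close> 75)
  is "\<lambda>c x k. c * x k"
  by (simp add: summable_square_scale)

instantiation ell2 :: real_vector
begin

lift_definition zero_ell2 :: ell2 is "\<lambda>_. 0"
  by simp

lift_definition plus_ell2 :: "ell2 \<Rightarrow> ell2 \<Rightarrow> ell2" is "\<lambda>x y k. x k + y k"
  by (simp add: summable_square_add)

lift_definition uminus_ell2 :: "ell2 \<Rightarrow> ell2" is "\<lambda>x k. - x k"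
  by simp

lift_definition minus_ell2 :: "ell2 \<Rightarrow> ell2 \<Rightarrow> ell2" is "\<lambda>x y k. x k - y k"
  subgoal for x y
    using summable_square_add[of x "\<lambda>k. - y k"] by simp
  done

definition scaleR_ell2 :: "real \<Rightarrow> ell2 \<Rightarrow> ell2" where
  "scaleR_ell2 r x = complex_of_real r *\<^sub>C x"

instance
  by standard
    (simp_all add: ell2_eq_iff scaleR_ell2_def zero_ell2.rep_eq plus_ell2.rep_eq
      uminus_ell2.rep_eq minus_ell2.rep_eq scaleC.rep_eq algebra_simps)

end

definition cinner :: "ell2 \<Rightarrow> ell2 \<Rightarrow> complex" where
  "cinner x y = (\<Sum>k. coord x k * cnj (coord y k))"

instantiation ell2 :: real_inner
begin

definition inner_ell2 :: "ell2 \<Rightarrow> ell2 \<Rightarrow> real" where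
  "inner_ell2 x y = Re (cinner x y)"

definition norm_ell2 :: "ell2 \<Rightarrow> real" where
  "norm_ell2 x = sqrt (\<Sum>k. (cmod (coord x k))\<^sup>2)"

definition sgn_ell2 :: "ell2 \<Rightarrow> ell2" where
  "sgn_ell2 x = x /\<^sub>R norm x"

definition dist_ell2 :: "ell2 \<Rightarrow> ell2 \<Rightarrow> real" where
  "dist_ell2 x y = norm (x - y)"

definition uniformity_ell2 :: "(ell2 \<times> ell2) filter" where
  "uniformity_ell2 = (INF e\<in>{0 <..}. principal {(x, y). dist x y < e})"

definition open_ell2 :: "ell2 set \<Rightarrow> bool" where
  "open_ell2 U \<longleftrightarrow> (\<forall>x\<in>U. \<forall>\<^sub>F (x', y) in uniformity. x' = x \<longrightarrow> y \<in> U)"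

instance
proof
  have inner_eq: "inner x y = (\<Sum>k. Re (coord x k * cnj (coord y k)))" for x y :: ell2
    by (simp add: inner_ell2_def cinner_def Re_suminf[OF summable_coord_mult])
  have sm: "summable (\<lambda>k. Re (coord x k * cnj (coord y k)))" for x y
    by (rule summable_Re[OF summable_coord_mult])
  have sq: "Re (z * cnj z) = (cmod z)\<^sup>2" for z
    by (metis Re_complex_of_real complex_norm_square)
  fix x y z :: ell2 and r :: real
  show "inner x y = inner y x"
    by (simp add: inner_eq mult.commute)
  show "inner (x + y) z = inner x z + inner y z"
    unfolding inner_eq suminf_add[OF sm sm]
    by (simp add: plus_ell2.rep_eq algebra_simps)
  show "inner (r *\<^sub>R x) y = r * inner x y"
    unfolding inner_eq suminf_mult[OF sm, symmetric]
    by (simp add: scaleR_ell2_def scaleC.rep_eq algebra_simps)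
  show "0 \<le> inner x x"
    unfolding inner_eq sq by (intro suminf_nonneg summable_coord) simp
  show "inner x x = 0 \<longleftrightarrow> x = 0"
    unfolding inner_eq sq
    by (subst suminf_eq_zero_iff[OF summable_coord])
      (auto simp: ell2_eq_iff zero_ell2.rep_eq)
  show "norm x = sqrt (inner x x)"
    unfolding inner_eq sq norm_ell2_def ..
qed (simp_all add: sgn_ell2_def dist_ell2_def uniformity_ell2_def open_ell2_def)

end

lemma norm_ell2_sq: "(norm x)\<^sup>2 = (\<Sum>k. (cmod (coord x k))\<^sup>2)"
  by (simp add: norm_ell2_def suminf_nonneg[OF summable_coord])

lemma sum_coord_le: "(\<Sum>k<n. (cmod (coord x k))\<^sup>2) \<le> (norm x)\<^sup>2"
  unfolding norm_ell2_sq by (rule sum_le_suminf[OF summable_coord]) auto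

lemma coord_le_norm: "cmod (coord x k) \<le> norm x"
proof (rule power2_le_imp_le)
  have "(cmod (coord x k))\<^sup>2 \<le> (\<Sum>i<Suc k. (cmod (coord x i))\<^sup>2)"
    by (rule member_le_sum) auto
  also have "\<dots> \<le> (norm x)\<^sup>2"
    by (rule sum_coord_le)
  finally show "(cmod (coord x k))\<^sup>2 \<le> (norm x)\<^sup>2" .
qed simp

instance ell2 :: banach
proof
  fix X :: "nat \<Rightarrow> ell2"
  assume C: "Cauchy X"
  have "Cauchy (\<lambda>n. coord (X n) k)" for k
    unfolding Cauchy_def
  proof (intro allI impI)
    fix e :: real
    assume "e > 0"
    then obtain M where M: "\<And>m n. m \<ge> M \<Longrightarrow> n \<ge> M \<Longrightarrow> dist (X m) (X n) < e"
      using C unfolding Cauchy_def by meson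
    have "dist (coord (X m) k) (coord (X n) k) \<le> dist (X m) (X n)" for m n
      using coord_le_norm[of "X m - X n" k] by (simp add: dist_norm minus_ell2.rep_eq)
    then show "\<exists>M. \<forall>m\<ge>M. \<forall>n\<ge>M. dist (coord (X m) k) (coord (X n) k) < e"
      using M by (meson le_less_trans)
  qed
  then have "\<exists>l. (\<lambda>n. coord (X n) k) \<longlonglongrightarrow> l" for k
    using Cauchy_convergent_iff convergent_def by blast
  then obtain a where a: "\<And>k. (\<lambda>n. coord (X n) k) \<longlonglongrightarrow> a k"
    by metis
  have *: "\<exists>M. \<forall>m\<ge>M. \<forall>K. (\<Sum>k<K. (cmod (coord (X m) k - a k))\<^sup>2) \<le> e\<^sup>2" if e: "e > 0" for e
  proof -
    obtain M where M: "\<And>m n. m \<ge> M \<Longrightarrow> n \<ge> M \<Longrightarrow> dist (X m) (X n) < e"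
      using C e unfolding Cauchy_def by meson
    show ?thesis
    proof (intro exI allI impI)
      fix m K
      assume m: "M \<le> m"
      show "(\<Sum>k<K. (cmod (coord (X m) k - a k))\<^sup>2) \<le> e\<^sup>2"
      proof (rule tendsto_upperbound)
        show "(\<lambda>n. \<Sum>k<K. (cmod (coord (X m) k - coord (X n) k))\<^sup>2)
          \<longlonglongrightarrow> (\<Sum>k<K. (cmod (coord (X m) k - a k))\<^sup>2)"
          by (intro tendsto_intros a)
        have "(\<Sum>k<K. (cmod (coord (X m) k - coord (X n) k))\<^sup>2) \<le> e\<^sup>2" if "n \<ge> M" for n
        proof -
          have "(\<Sum>k<K. (cmod (coord (X m - X n) k))\<^sup>2) \<le> (norm (X m - X n))\<^sup>2"
            by (rule sum_coord_le)
          also have "\<dots> \<le> e\<^sup>2"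
            using M[OF m that] by (intro power_mono) (auto simp: dist_norm)
          finally show ?thesis
            by (simp add: minus_ell2.rep_eq)
        qed
        then show "\<forall>\<^sub>F n in sequentially. (\<Sum>k<K. (cmod (coord (X m) k - coord (X n) k))\<^sup>2) \<le> e\<^sup>2"
          using eventually_sequentially by blast
      qed simp
    qed
  qed
  obtain M where M: "\<forall>m\<ge>M. \<forall>K. (\<Sum>k<K. (cmod (coord (X m) k - a k))\<^sup>2) \<le> 1\<^sup>2"
    using *[of 1] by auto
  have "summable (\<lambda>k. (cmod (coord (X M) k - a k))\<^sup>2)"
    by (rule summableI_nonneg_bounded[where x = "1\<^sup>2"]) (use M in auto)
  then have "summable (\<lambda>k. (cmod (coord (X M) k + - 1 * (coord (X M) k - a k)))\<^sup>2)"
    by (intro summable_square_add summable_coord summable_square_scale)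
  then have sa: "summable (\<lambda>k. (cmod (a k))\<^sup>2)"
    by simp
  define A where "A = Abs_ell2 a"
  have A: "coord A = a"
    using sa by (simp add: A_def Abs_ell2_inverse)
  have "X \<longlonglongrightarrow> A"
  proof (rule metric_LIMSEQ_I)
    fix e :: real
    assume e: "e > 0"
    then obtain N where N: "\<forall>m\<ge>N. \<forall>K. (\<Sum>k<K. (cmod (coord (X m) k - a k))\<^sup>2) \<le> (e / 2)\<^sup>2"
      using *[of "e / 2"] by auto
    have "dist (X m) A < e" if "m \<ge> N" for m
    proof -
      have "(norm (X m - A))\<^sup>2 \<le> (e / 2)\<^sup>2"
        unfolding norm_ell2_sq
        by (rule suminf_le_const[OF summable_coord]) (use N that in \<open>simp add: minus_ell2.rep_eq A\<close>)
      then have "norm (X m - A) \<le> e / 2"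
        by (rule power2_le_imp_le) (use e in simp)
      then show ?thesis
        using e by (simp add: dist_norm)
    qed
    then show "\<exists>no. \<forall>n\<ge>no. dist (X n) A < e"
      by blast
  qed
  then show "convergent X"
    by (auto simp: convergent_def)
qed

global_interpretation ell2: vector_space scaleC
  by unfold_locales
    (simp_all add: ell2_eq_iff plus_ell2.rep_eq scaleC.rep_eq algebra_simps)

text \<open>The constants \<open>ell2.subspace\<close> and \<open>ell2.span\<close> thus refer to complex scalars.\<close>

lift_definition ell2_basis :: "nat \<Rightarrow> ell2" is "\<lambda>k i. if i = k then 1 else 0"
  subgoal for k
    by (rule summable_finite[of "{k}"]) auto
  done

definition ell2_n :: "nat \<Rightarrow> ell2 set" where
  "ell2_n n = ell2.span (ell2_basis ` {..<n})"

definition orth_compl :: "ell2 set \<Rightarrow> ell2 set" where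
  "orth_compl S = {x. \<forall>y\<in>S. cinner x y = 0}"


section \<open>Operators on subspaces\<close>

text \<open>An operator on a subspace \<open>S\<close> is represented by a function \<open>A :: ell2 \<Rightarrow> ell2\<close>; every notion
  below depends only on the values of \<open>A\<close> on \<open>S\<close>.  Operators on the whole space are those on
  \<open>UNIV\<close>.\<close>

definition bounded_op_on :: "ell2 set \<Rightarrow> (ell2 \<Rightarrow> ell2) \<Rightarrow> bool" where
  "bounded_op_on S A \<longleftrightarrow>
     (\<forall>x\<in>S. A x \<in> S) \<and>
     (\<forall>x\<in>S. \<forall>y\<in>S. A (x + y) = A x + A y) \<and>
     (\<forall>c. \<forall>x\<in>S. A (c *\<^sub>C x) = c *\<^sub>C A x) \<and>
     (\<exists>K. \<forall>x\<in>S. norm (A x) \<le> K * norm x)"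

text \<open>The same formula as the library's \<open>onorm\<close>, with the supremum taken over \<open>S\<close>.\<close>

definition onorm_on :: "ell2 set \<Rightarrow> (ell2 \<Rightarrow> ell2) \<Rightarrow> real" where
  "onorm_on S A = (SUP x\<in>S. norm (A x) / norm x)"

definition adjoint_on :: "ell2 set \<Rightarrow> (ell2 \<Rightarrow> ell2) \<Rightarrow> (ell2 \<Rightarrow> ell2) \<Rightarrow> bool" where
  "adjoint_on S A B \<longleftrightarrow>
     bounded_op_on S B \<and> (\<forall>x\<in>S. \<forall>y\<in>S. cinner (A x) y = cinner x (B y))"

text \<open>Normal operators are bounded by definition.  The adjoint is taken within \<open>S\<close>; its values
  on \<open>S\<close> are uniquely determined.\<close>

definition normal_op_on :: "ell2 set \<Rightarrow> (ell2 \<Rightarrow> ell2) \<Rightarrow> bool" where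
  "normal_op_on S A \<longleftrightarrow>
     bounded_op_on S A \<and> (\<exists>B. adjoint_on S A B \<and> (\<forall>x\<in>S. A (B x) = B (A x)))"

definition spectrum_on :: "ell2 set \<Rightarrow> (ell2 \<Rightarrow> ell2) \<Rightarrow> complex set" where
  "spectrum_on S A =
     {z. \<not> (\<exists>B. bounded_op_on S B \<and>
            (\<forall>x\<in>S. B (A x - z *\<^sub>C x) = x \<and> A (B x) - z *\<^sub>C B x = x))}"

definition eigenspace_on :: "ell2 set \<Rightarrow> (ell2 \<Rightarrow> ell2) \<Rightarrow> complex \<Rightarrow> ell2 set" where
  "eigenspace_on S A z = {x\<in>S. A x = z *\<^sub>C x}"

definition ess_spectrum_on :: "ell2 set \<Rightarrow> (ell2 \<Rightarrow> ell2) \<Rightarrow> complex set" where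
  "ess_spectrum_on S A =
     spectrum_on S A -
     {z. z isolated_in spectrum_on S A \<and> eigenspace_on S A z \<noteq> {0} \<and>
         (\<exists>F. finite F \<and> eigenspace_on S A z = ell2.span F)}"

definition band_op :: "(ell2 \<Rightarrow> ell2) \<Rightarrow> bool" where
  "band_op T \<longleftrightarrow>
     (\<exists>N::nat. \<forall>i j. \<bar>int i - int j\<bar> > int N \<longrightarrow> cinner (T (ell2_basis j)) (ell2_basis i) = 0)"


section \<open>Truncations\<close>

text \<open>\<open>Q\<close> is the projection on \<open>S\<close> along \<open>S'\<close>.  The decomposition \<open>x = Q x + (x - Q x)\<close> gives
  \<open>S + S' = UNIV\<close>, hence the algebraic direct sum, and it determines \<open>Q\<close>.  Neither \<open>S'\<close> is
  assumed closed nor \<open>Q\<close> bounded.\<close>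

definition projection_along :: "(ell2 \<Rightarrow> ell2) \<Rightarrow> ell2 set \<Rightarrow> ell2 set \<Rightarrow> bool" where
  "projection_along Q S S' \<longleftrightarrow>
     ell2.subspace S \<and> ell2.subspace S' \<and> S \<inter> S' = {0} \<and>
     (\<forall>x. Q x \<in> S \<and> x - Q x \<in> S')"

definition truncation_on :: "ell2 set \<Rightarrow> (ell2 \<Rightarrow> ell2) \<Rightarrow> (ell2 \<Rightarrow> ell2) \<Rightarrow> bool" where
  "truncation_on S T A \<longleftrightarrow> (\<exists>Q S'. projection_along Q S S' \<and> (\<forall>x\<in>S. A x = Q (T x)))"

definition normal_truncation_on :: "ell2 set \<Rightarrow> (ell2 \<Rightarrow> ell2) \<Rightarrow> (ell2 \<Rightarrow> ell2) \<Rightarrow> bool" where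
  "normal_truncation_on S T A \<longleftrightarrow> truncation_on S T A \<and> normal_op_on S A"

text \<open>The operator \<open>A \<oplus> 0\<close> on \<open>S \<oplus> orth_compl S\<close>, for closed \<open>S\<close>: the operator \<open>A\<close> composed with
  the orthogonal projection on \<open>S\<close>.\<close>

definition extend_zero :: "ell2 set \<Rightarrow> (ell2 \<Rightarrow> ell2) \<Rightarrow> ell2 \<Rightarrow> ell2" where
  "extend_zero S A x = A (THE s. s \<in> S \<and> x - s \<in> orth_compl S)"

end

theory Submission
  imports Defs
begin

text \<open>
  Band structure enters only through supports: with band width \<open>N\<close>, the operator \<open>T\<close> moves the
  support of a sequence by at most \<open>N\<close>.  A truncation \<open>A x = Q (T x)\<close> on \<open>S\<close> agrees with \<open>T\<close> at every
  \<open>x \<in> S\<close> with \<open>T x \<in> S\<close>, because the projection \<open>Q\<close> fixes \<open>S\<close>.  So a truncation on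
  \<open>ell2_n n\<close> agrees with \<open>T\<close> on \<open>ell2_n p\<close> as soon as \<open>p + N \<le> n\<close>, and a truncation on the orthogonal
  complement of \<open>ell2_n n\<close> agrees with \<open>T\<close> on all sequences that vanish below \<open>n + N\<close>.  Strong
  convergence follows by density of the finitely supported sequences and the bound on the norms.

  The rest is operator theory of normal operators, on a closed subspace.  A normal operator that is
  bounded below is invertible (\<open>normal_bounded_below_surj\<close>), so that points of the spectrum are
  approximate eigenvalues.  Conversely, a unit vector \<open>x\<close> with \<open>norm (A x - z x) \<le> e\<close> forces a point of
  the spectrum of \<open>A\<close> within distance \<open>e\<close> of \<open>z\<close> (\<open>spectrum_near_approx_eigenvalue\<close>).  For a
  point \<open>z\<close> of the spectrum of \<open>T\<close>, a finitely supported approximate eigenvector of \<open>T\<close> is eventually an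
  approximate eigenvector of all the truncations with the same defect, which gives the
  first inclusion.

  The equality of essential spectra rests on a form of Weyl's criterion
  (\<open>not_in_ess_spectrum_iff_bounded_below_on_tail\<close>): \<open>z\<close> is outside the essential spectrum of a
  normal \<open>A\<close> iff \<open>A - z\<close> is bounded below on the sequences vanishing below some index \<open>m\<close>.  As \<open>m\<close> may
  be taken larger than \<open>n + N\<close>, the operators \<open>T\<close> and \<open>A\<close> pass this test for the same \<open>z\<close>.

  The distance estimate comes from the parallelogram law: a uniform lower bound for \<open>A - w\<close> over a
  circle improves relative to the radius with every squaring of \<open>A\<close>, up to a contradiction
  (\<open>circle_lower_bound_doubling\<close>).  In Weyl's criterion, suppose that \<open>z\<close> is isolated in the spectrum.
  Then the distance estimate at points near \<open>z\<close> bounds the quadratic form of \<open>C = A - z\<close> by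
  \<open>norm (C x)\<^sup>2\<close> (\<open>quadratic_form_le_if_isolated\<close>).  This makes \<open>C\<close> bounded below on its own range,
  which splits the eigenspace off from a part where \<open>C\<close> is invertible.
\<close>

section \<open>The inner product of the sequence space\<close>

lemmas coord_simps = zero_ell2.rep_eq plus_ell2.rep_eq minus_ell2.rep_eq uminus_ell2.rep_eq
  scaleC.rep_eq ell2_basis.rep_eq

lemma cinner_add_left: "cinner (x + y) z = cinner x z + cinner y z"
  unfolding cinner_def suminf_add[OF summable_coord_mult summable_coord_mult]
  by (simp add: coord_simps algebra_simps)

lemma cinner_scaleC_left: "cinner (c *\<^sub>C x) y = c * cinner x y"
  unfolding cinner_def suminf_mult[OF summable_coord_mult, symmetric]
  by (simp add: coord_simps algebra_simps)

lemma cinner_commute: "cinner y x = cnj (cinner x y)"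
proof -
  have "(\<lambda>k. cnj (coord x k * cnj (coord y k))) sums cnj (cinner x y)"
    unfolding sums_cnj cinner_def using summable_coord_mult by (rule summable_sums)
  then show ?thesis
    unfolding cinner_def by (simp add: sums_iff mult.commute)
qed

lemma cinner_add_right: "cinner x (y + z) = cinner x y + cinner x z"
  using cinner_add_left[of y z x] by (metis cinner_commute complex_cnj_add)

lemma cinner_scaleC_right: "cinner x (c *\<^sub>C y) = cnj c * cinner x y"
  using cinner_scaleC_left[of c y x] by (metis cinner_commute complex_cnj_mult)

lemma minus_eq_scaleC: "- x = (- 1) *\<^sub>C (x :: ell2)"
  by (simp add: ell2_eq_iff coord_simps)

lemma cinner_diff_left: "cinner (x - y) z = cinner x z - cinner y z"
  using cinner_add_left[of "x - y" y z] by simp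

lemma cinner_diff_right: "cinner x (y - z) = cinner x y - cinner x z"
  using cinner_add_right[of x "y - z" z] by simp

lemma cinner_zero [simp]: "cinner 0 x = 0" "cinner x 0 = 0"
  by (simp_all add: cinner_def coord_simps)

lemmas cinner_simps = cinner_add_left cinner_add_right cinner_diff_left cinner_diff_right
  cinner_scaleC_left cinner_scaleC_right

lemma cinner_self: "cinner x x = of_real ((norm x)\<^sup>2)"
proof -
  have "cinner x x = (\<Sum>k. of_real ((cmod (coord x k))\<^sup>2))"
    by (simp only: cinner_def complex_norm_square)
  also have "\<dots> = of_real ((norm x)\<^sup>2)"
    unfolding norm_ell2_sq by (rule suminf_of_real[OF summable_coord, symmetric])
  finally show ?thesis .
qed

lemma norm_scaleC [simp]: "norm (c *\<^sub>C x) = cmod c * norm (x :: ell2)"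
proof -
  have "complex_of_real ((norm (c *\<^sub>C x))\<^sup>2) = of_real ((cmod c * norm x)\<^sup>2)"
    by (simp only: cinner_self[symmetric] power_mult_distrib of_real_mult complex_norm_square
        cinner_simps mult_ac)
  then have "(norm (c *\<^sub>C x))\<^sup>2 = (cmod c * norm x)\<^sup>2"
    using of_real_eq_iff by blast
  then show ?thesis
    by (simp add: power2_eq_iff_nonneg)
qed

text \<open>The Cauchy--Schwarz inequality of the underlying real inner product, applied after rotating
  \<open>x\<close> so that the complex inner product becomes a nonnegative real.\<close>

lemma cinner_le_norm: "cmod (cinner x y) \<le> norm x * norm y"
proof (cases "cinner x y = 0")
  case False
  define c where "c = cinner x y"
  define u where "u = cnj c / cmod c"
  have c: "cmod c \<noteq> 0"
    using False by (simp add: c_def)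
  have "cinner (u *\<^sub>C x) y = cmod c"
    using c complex_norm_square[of c]
    by (simp add: cinner_simps u_def c_def[symmetric] field_simps power2_eq_square)
  then have "cmod c = inner (u *\<^sub>C x) y"
    by (simp add: inner_ell2_def)
  also have "\<dots> \<le> norm (u *\<^sub>C x) * norm y"
    by (rule norm_cauchy_schwarz)
  finally show ?thesis
    using c by (simp add: u_def norm_divide c_def)
qed simp

lemma norm_diff_sq: "(norm (x - y))\<^sup>2 = (norm x)\<^sup>2 - 2 * Re (cinner x y) + (norm (y :: ell2))\<^sup>2"
  unfolding power2_norm_eq_inner
  by (simp add: inner_diff inner_commute inner_ell2_def[symmetric])

lemma norm_add_sq: "(norm (x + y))\<^sup>2 = (norm x)\<^sup>2 + 2 * Re (cinner x y) + (norm (y :: ell2))\<^sup>2"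
  unfolding power2_norm_eq_inner
  by (simp add: inner_add inner_commute inner_ell2_def[symmetric])

lemma coord_eq_cinner: "coord x k = cinner x (ell2_basis k)"
proof -
  have "(\<lambda>i. coord x i * cnj (coord (ell2_basis k) i)) sums
      (\<Sum>i\<in>{k}. coord x i * cnj (coord (ell2_basis k) i))"
    by (rule sums_finite) (auto simp: coord_simps)
  then show ?thesis
    by (simp add: cinner_def sums_iff coord_simps)
qed

lemma bounded_linear_scaleC: "bounded_linear (\<lambda>x. c *\<^sub>C x)"
  by (rule bounded_linear_intro[where K = "cmod c"])
    (simp_all add: ell2_eq_iff scaleR_ell2_def coord_simps algebra_simps)

lemma bounded_linear_scaleC_left: "bounded_linear (\<lambda>c. c *\<^sub>C x)"
  by (rule bounded_linear_intro[where K = "norm x"])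
    (simp_all add: ell2_eq_iff scaleR_ell2_def coord_simps scaleR_conv_of_real algebra_simps)

lemma bounded_linear_coord: "bounded_linear (\<lambda>x. coord x k)"
  by (rule bounded_linear_intro[where K = 1])
    (simp_all add: scaleR_ell2_def coord_simps scaleR_conv_of_real coord_le_norm)

lemma bounded_linear_cinner_left: "bounded_linear (\<lambda>x. cinner x y)"
  by (rule bounded_linear_intro[where K = "norm y"])
    (simp_all add: scaleR_ell2_def cinner_simps scaleR_conv_of_real cinner_le_norm)

lemmas tendsto_coord = bounded_linear.tendsto[OF bounded_linear_coord]
lemmas tendsto_scaleC = bounded_linear.tendsto[OF bounded_linear_scaleC]
lemmas tendsto_scaleC_left = bounded_linear.tendsto[OF bounded_linear_scaleC_left]
lemmas tendsto_cinner_left = bounded_linear.tendsto[OF bounded_linear_cinner_left]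

section \<open>Operators on a subspace\<close>

lemma
  assumes "bounded_op_on S A"
  shows bounded_op_on_in: "x \<in> S \<Longrightarrow> A x \<in> S"
    and bounded_op_on_add: "x \<in> S \<Longrightarrow> y \<in> S \<Longrightarrow> A (x + y) = A x + A y"
    and bounded_op_on_scaleC: "x \<in> S \<Longrightarrow> A (c *\<^sub>C x) = c *\<^sub>C A x"
  using assms by (auto simp: bounded_op_on_def)

lemma bounded_op_on_bound:
  assumes "bounded_op_on S A"
  obtains K where "K > 0" "\<And>x. x \<in> S \<Longrightarrow> norm (A x) \<le> K * norm x"
proof -
  obtain K where K: "\<forall>x\<in>S. norm (A x) \<le> K * norm x"
    using assms by (auto simp: bounded_op_on_def)
  have "norm (A x) \<le> (\<bar>K\<bar> + 1) * norm x" if "x \<in> S" for x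
  proof -
    have "K * norm x \<le> (\<bar>K\<bar> + 1) * norm x"
      by (intro mult_right_mono) auto
    then show ?thesis
      using K that by fastforce
  qed
  then show ?thesis
    using that[of "\<bar>K\<bar> + 1"] by auto
qed

lemma bounded_op_on_diff:
  assumes "bounded_op_on S A" "ell2.subspace S" "x \<in> S" "y \<in> S"
  shows "A (x - y) = A x - A y"
  using bounded_op_on_add[OF assms(1), of x "(- 1) *\<^sub>C y"]
    bounded_op_on_scaleC[OF assms(1), of y "- 1"] assms
  by (simp add: minus_eq_scaleC[symmetric] ell2.subspace_neg)

lemma bounded_op_on_tendsto:
  assumes A: "bounded_op_on S A" and S: "ell2.subspace S"
    and X: "\<And>n. X n \<in> S" "x \<in> S" "X \<longlonglongrightarrow> x"
  shows "(\<lambda>n. A (X n)) \<longlonglongrightarrow> A x"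
proof -
  obtain K where K: "K > 0" "\<And>x. x \<in> S \<Longrightarrow> norm (A x) \<le> K * norm x"
    using bounded_op_on_bound[OF A] by blast
  have lim: "(\<lambda>n. K * norm (X n - x)) \<longlonglongrightarrow> 0"
    using tendsto_mult[OF tendsto_const[of K] tendsto_norm[OF LIM_zero[OF X(3)]]] by simp
  have "(\<lambda>n. A (X n) - A x) \<longlonglongrightarrow> 0"
  proof (rule Lim_null_comparison[OF _ lim], rule eventuallyI)
    fix n
    show "norm (A (X n) - A x) \<le> K * norm (X n - x)"
      using K(2)[of "X n - x"] X S by (simp add: bounded_op_on_diff[OF A S] ell2.subspace_diff)
  qed
  then show ?thesis
    by (rule LIM_zero_cancel)
qed

lemma normal_op_onE:
  assumes "normal_op_on S A"
  obtains B where "bounded_op_on S A" "bounded_op_on S B"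
    "\<And>x y. x \<in> S \<Longrightarrow> y \<in> S \<Longrightarrow> cinner (A x) y = cinner x (B y)"
    "\<And>x. x \<in> S \<Longrightarrow> A (B x) = B (A x)"
  using assms unfolding normal_op_on_def adjoint_on_def by auto

lemma norm_adjoint_eq:
  assumes "bounded_op_on S A" "bounded_op_on S B"
    "\<And>x y. x \<in> S \<Longrightarrow> y \<in> S \<Longrightarrow> cinner (A x) y = cinner x (B y)"
    "\<And>x. x \<in> S \<Longrightarrow> A (B x) = B (A x)"
    and x: "x \<in> S"
  shows "norm (B x) = norm (A x)"
proof -
  have mem: "A x \<in> S" "B x \<in> S"
    using assms by (auto simp: bounded_op_on_in)
  have "cinner (B x) (B x) = cinner (A (B x)) x"
    using assms(3)[of "B x" x] mem x by simp
  also have "\<dots> = cnj (cinner x (B (A x)))"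
    using assms x by (metis cinner_commute)
  also have "\<dots> = cnj (cinner (A x) (A x))"
    using assms mem by simp
  finally have "complex_of_real ((norm (B x))\<^sup>2) = of_real ((norm (A x))\<^sup>2)"
    by (simp add: cinner_self)
  then have "(norm (B x))\<^sup>2 = (norm (A x))\<^sup>2"
    using of_real_eq_iff by blast
  then show ?thesis
    by (simp add: power2_eq_iff_nonneg)
qed

lemma bounded_op_on_shift:
  assumes A: "bounded_op_on S A" and S: "ell2.subspace S"
  shows "bounded_op_on S (\<lambda>x. A x - z *\<^sub>C x)"
proof -
  obtain K where K: "K > 0" "\<And>x. x \<in> S \<Longrightarrow> norm (A x) \<le> K * norm x"
    using bounded_op_on_bound[OF A] by blast
  have "norm (A x - z *\<^sub>C x) \<le> (K + cmod z) * norm x" if "x \<in> S" for x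
    using norm_triangle_ineq4[of "A x" "z *\<^sub>C x"] K(2)[OF that] by (simp add: algebra_simps)
  then have "\<exists>K. \<forall>x\<in>S. norm (A x - z *\<^sub>C x) \<le> K * norm x"
    by blast
  then show ?thesis
    using A S unfolding bounded_op_on_def
    by (simp add: ell2.subspace_diff ell2.subspace_scale ell2.scale_right_distrib
        ell2.scale_right_diff_distrib mult.commute)
qed

lemma normal_op_on_shift:
  assumes A: "normal_op_on S A" and S: "ell2.subspace S"
  shows "normal_op_on S (\<lambda>x. A x - z *\<^sub>C x)"
proof -
  obtain B where B: "bounded_op_on S A" "bounded_op_on S B"
    "\<And>x y. x \<in> S \<Longrightarrow> y \<in> S \<Longrightarrow> cinner (A x) y = cinner x (B y)"
    "\<And>x. x \<in> S \<Longrightarrow> A (B x) = B (A x)"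
    using normal_op_onE[OF A] by blast
  let ?B = "\<lambda>x. B x - cnj z *\<^sub>C x"
  have "adjoint_on S (\<lambda>x. A x - z *\<^sub>C x) ?B"
    unfolding adjoint_on_def by (simp add: bounded_op_on_shift[OF B(2) S] cinner_simps B(3))
  moreover have "A (?B x) - z *\<^sub>C ?B x = B (A x - z *\<^sub>C x) - cnj z *\<^sub>C (A x - z *\<^sub>C x)"
    if "x \<in> S" for x
    using that S B(4)[OF that]
    by (simp add: bounded_op_on_diff[OF B(1) S] bounded_op_on_diff[OF B(2) S] bounded_op_on_in[OF B(1)]
        bounded_op_on_in[OF B(2)] bounded_op_on_scaleC[OF B(1)] bounded_op_on_scaleC[OF B(2)]
        ell2.subspace_scale ell2.scale_right_diff_distrib algebra_simps)
  ultimately show ?thesis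
    unfolding normal_op_on_def using bounded_op_on_shift[OF B(1) S] by blast
qed

lemma bounded_op_on_compose:
  assumes A: "bounded_op_on S A" and B: "bounded_op_on S B"
  shows "bounded_op_on S (\<lambda>x. A (B x))"
proof -
  obtain K where K: "K > 0" "\<And>x. x \<in> S \<Longrightarrow> norm (A x) \<le> K * norm x"
    using bounded_op_on_bound[OF A] by blast
  obtain L where L: "L > 0" "\<And>x. x \<in> S \<Longrightarrow> norm (B x) \<le> L * norm x"
    using bounded_op_on_bound[OF B] by blast
  have "norm (A (B x)) \<le> K * L * norm x" if "x \<in> S" for x
  proof -
    have "norm (A (B x)) \<le> K * norm (B x)"
      using K that by (simp add: bounded_op_on_in[OF B])
    also have "\<dots> \<le> K * (L * norm x)"
      using K L that by (simp add: mult_left_mono)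
    finally show ?thesis
      by (simp add: algebra_simps)
  qed
  then show ?thesis
    using A B unfolding bounded_op_on_def by auto
qed

lemma normal_op_on_square:
  assumes A: "normal_op_on S A"
  shows "normal_op_on S (\<lambda>x. A (A x))"
proof -
  obtain B where B: "bounded_op_on S A" "bounded_op_on S B"
    "\<And>x y. x \<in> S \<Longrightarrow> y \<in> S \<Longrightarrow> cinner (A x) y = cinner x (B y)"
    "\<And>x. x \<in> S \<Longrightarrow> A (B x) = B (A x)"
    using normal_op_onE[OF A] by blast
  have "adjoint_on S (\<lambda>x. A (A x)) (\<lambda>x. B (B x))"
    unfolding adjoint_on_def
    using B bounded_op_on_in[OF B(1)] bounded_op_on_in[OF B(2)] bounded_op_on_compose by auto
  moreover have "A (A (B (B x))) = B (B (A (A x)))" if "x \<in> S" for x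
    using that B bounded_op_on_in[OF B(1)] bounded_op_on_in[OF B(2)] by auto
  ultimately show ?thesis
    unfolding normal_op_on_def using bounded_op_on_compose[OF B(1) B(1)] by blast
qed

lemma normal_norm_sq_le:
  assumes A: "normal_op_on S A" and x: "x \<in> S"
  shows "(norm (A x))\<^sup>2 \<le> norm (A (A x)) * norm x"
proof -
  obtain B where B: "bounded_op_on S A" "bounded_op_on S B"
    "\<And>x y. x \<in> S \<Longrightarrow> y \<in> S \<Longrightarrow> cinner (A x) y = cinner x (B y)"
    "\<And>x. x \<in> S \<Longrightarrow> A (B x) = B (A x)"
    using normal_op_onE[OF A] by blast
  have "(norm (A x))\<^sup>2 = cmod (cinner (A x) (A x))"
    by (simp add: cinner_self norm_power)
  also have "\<dots> = cmod (cinner x (B (A x)))"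
    using B x by (simp add: bounded_op_on_in[OF B(1)])
  also have "\<dots> \<le> norm x * norm (B (A x))"
    by (rule cinner_le_norm)
  also have "norm (B (A x)) = norm (A (A x))"
    using norm_adjoint_eq[OF B] x by (simp add: bounded_op_on_in[OF B(1)])
  finally show ?thesis
    by (simp add: mult.commute)
qed

text \<open>Normality makes the adjoint \<open>B\<close> commute with \<open>A\<close>, so it is enough to solve \<open>B (A x) = y\<close>.  The operator
  \<open>B A\<close> is positive and bounded below, hence \<open>x - t (B (A x) - y)\<close> is a contraction in \<open>x\<close>
  for small \<open>t > 0\<close>.\<close>

lemma normal_bounded_below_surj:
  assumes A: "normal_op_on S A" and S: "ell2.subspace S" "closed S"
    and c: "c > 0" "\<And>x. x \<in> S \<Longrightarrow> c * norm x \<le> norm (A x)" and y: "y \<in> S"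
  shows "\<exists>x\<in>S. A x = y"
proof -
  obtain B where B: "bounded_op_on S A" "bounded_op_on S B"
    "\<And>x y. x \<in> S \<Longrightarrow> y \<in> S \<Longrightarrow> cinner (A x) y = cinner x (B y)"
    "\<And>x. x \<in> S \<Longrightarrow> A (B x) = B (A x)"
    using normal_op_onE[OF A] by blast
  note BA = bounded_op_on_compose[OF B(2) B(1)]
  obtain K0 where K0: "K0 > 0" "\<And>x. x \<in> S \<Longrightarrow> norm (B (A x)) \<le> K0 * norm x"
    using bounded_op_on_bound[OF BA] by blast
  \<comment> \<open>A bound of at least \<open>c\<^sup>2\<close> keeps the radicand of \<open>q\<close> below nonnegative.\<close>
  define K where "K = max K0 (c\<^sup>2)"
  have K: "norm (B (A x)) \<le> K * norm x" if "x \<in> S" for x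
    using K0(2)[OF that] mult_right_mono[of K0 K "norm x"] by (auto simp: K_def)
  have Kc: "K > 0" "K \<ge> c\<^sup>2"
    using K0(1) by (auto simp: K_def)
  \<comment> \<open>The value of \<open>t\<close> that minimises the bound \<open>1 - 2 t c\<^sup>2 + t\<^sup>2 K\<^sup>2\<close> of the squared contraction
    factor.\<close>
  define t where "t = c\<^sup>2 / K\<^sup>2"
  define q where "q = sqrt (1 - (c\<^sup>2 / K)\<^sup>2)"
  have r: "0 < c\<^sup>2 / K" "c\<^sup>2 / K \<le> 1"
    using Kc c by (auto simp: field_simps)
  then have r2: "(c\<^sup>2 / K)\<^sup>2 \<le> 1" "0 < (c\<^sup>2 / K)\<^sup>2"
    by (auto simp: power_le_one)
  have q: "0 \<le> q" "q < 1"
    using r2 by (auto simp: q_def)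
  define f where "f x = x - of_real t *\<^sub>C (B (A x) - y)" for x
  have step: "norm (u - of_real t *\<^sub>C B (A u)) \<le> q * norm u" if u: "u \<in> S" for u
  proof (rule power2_le_imp_le)
    have "cinner u (B (A u)) = of_real ((norm (A u))\<^sup>2)"
      using B u bounded_op_on_in[OF B(1)] cinner_self by metis
    then have "(norm (u - of_real t *\<^sub>C B (A u)))\<^sup>2
        = (norm u)\<^sup>2 - 2 * t * (norm (A u))\<^sup>2 + t\<^sup>2 * (norm (B (A u)))\<^sup>2"
      by (simp add: norm_diff_sq cinner_simps power_mult_distrib)
    also have "\<dots> \<le> (norm u)\<^sup>2 - 2 * t * (c * norm u)\<^sup>2 + t\<^sup>2 * (K * norm u)\<^sup>2"
      using c u K[OF u] Kc
      by (intro add_mono diff_mono mult_left_mono power_mono) (auto simp: t_def)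
    also have "\<dots> = (1 - (c\<^sup>2 / K)\<^sup>2) * (norm u)\<^sup>2"
      using Kc by (simp add: t_def field_simps power2_eq_square)
    also have "\<dots> = (q * norm u)\<^sup>2"
      using r2 by (simp add: q_def power_mult_distrib)
    finally show "(norm (u - of_real t *\<^sub>C B (A u)))\<^sup>2 \<le> (q * norm u)\<^sup>2" .
  qed (use q in simp)
  have "\<exists>!x\<in>S. f x = x"
  proof (rule Banach_fix)
    show "complete S"
      using S(2) by (simp add: complete_eq_closed)
    show "S \<noteq> {}"
      using y by auto
    show "f ` S \<subseteq> S"
      using S(1) y bounded_op_on_in[OF BA]
      by (auto simp: f_def ell2.subspace_diff ell2.subspace_scale)
    fix u v
    assume uv: "u \<in> S" "v \<in> S"
    have "f u - f v = (u - v) - of_real t *\<^sub>C B (A (u - v))"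
      unfolding f_def bounded_op_on_diff[OF BA S(1) uv]
      by (simp add: ell2.scale_right_diff_distrib)
    then show "dist (f u) (f v) \<le> q * dist u v"
      using step[of "u - v"] uv S(1) by (simp add: dist_norm ell2.subspace_diff)
  qed (use q in auto)
  then obtain x where x: "x \<in> S" "f x = x"
    by blast
  have "of_real t *\<^sub>C (B (A x) - y) = 0"
    using x(2) by (simp add: f_def)
  then have "B (A x) = y"
    using c Kc by (simp add: t_def)
  then have "A (B x) = y"
    using B(4)[OF x(1)] by simp
  then show ?thesis
    using bounded_op_on_in[OF B(2) x(1)] by blast
qed

lemma not_in_spectrum_iff_bounded_below:
  assumes A: "normal_op_on S A" and S: "ell2.subspace S" "closed S"
  shows "z \<notin> spectrum_on S A \<longleftrightarrow> (\<exists>c>0. \<forall>x\<in>S. c * norm x \<le> norm (A x - z *\<^sub>C x))"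
proof
  assume "z \<notin> spectrum_on S A"
  then obtain R where R: "bounded_op_on S R" "\<And>x. x \<in> S \<Longrightarrow> R (A x - z *\<^sub>C x) = x"
    by (auto simp: spectrum_on_def)
  obtain K where K: "K > 0" "\<And>x. x \<in> S \<Longrightarrow> norm (R x) \<le> K * norm x"
    using bounded_op_on_bound[OF R(1)] by blast
  have "(1 / K) * norm x \<le> norm (A x - z *\<^sub>C x)" if "x \<in> S" for x
  proof -
    have "A x - z *\<^sub>C x \<in> S"
      using bounded_op_on_shift[of S A z] A S that
      by (auto simp: normal_op_on_def bounded_op_on_def)
    then show ?thesis
      using K(1) K(2)[of "A x - z *\<^sub>C x"] R(2)[OF that] by (simp add: field_simps)
  qed
  then show "\<exists>c>0. \<forall>x\<in>S. c * norm x \<le> norm (A x - z *\<^sub>C x)"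
    using K(1) by (intro exI[of _ "1 / K"]) auto
next
  assume "\<exists>c>0. \<forall>x\<in>S. c * norm x \<le> norm (A x - z *\<^sub>C x)"
  then obtain c where c: "c > 0" "\<And>x. x \<in> S \<Longrightarrow> c * norm x \<le> norm (A x - z *\<^sub>C x)"
    by blast
  define C where "C x = A x - z *\<^sub>C x" for x
  have C: "normal_op_on S C"
    using normal_op_on_shift[OF A S(1), of z] by (simp add: C_def[abs_def])
  then have bC: "bounded_op_on S C"
    by (simp add: normal_op_on_def)
  have inj: "x = y" if "x \<in> S" "y \<in> S" "C x = C y" for x y
  proof -
    have "C (x - y) = 0"
      using bounded_op_on_diff[OF bC S(1)] that by simp
    then have "c * norm (x - y) \<le> 0"
      using c(2)[of "x - y"] that S by (simp add: C_def ell2.subspace_diff)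
    then show ?thesis
      using c(1) by (simp add: mult_le_0_iff)
  qed
  have "\<exists>x\<in>S. C x = y" if "y \<in> S" for y
    using normal_bounded_below_surj[OF C S c(1) _ that] c(2) by (simp add: C_def)
  then obtain R where R: "\<And>y. y \<in> S \<Longrightarrow> R y \<in> S" "\<And>y. y \<in> S \<Longrightarrow> C (R y) = y"
    by metis
  have RC: "R (C x) = x" if "x \<in> S" for x
    using inj[of "R (C x)" x] R that bounded_op_on_in[OF bC] by auto
  have "bounded_op_on S R"
    unfolding bounded_op_on_def
  proof (intro conjI ballI allI)
    fix x y k
    assume x: "x \<in> S"
    show "R (k *\<^sub>C x) = k *\<^sub>C R x"
      by (rule inj) (use R x S(1) bounded_op_on_scaleC[OF bC] in \<open>auto simp: ell2.subspace_scale\<close>)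
    show "R (x + y) = R x + R y" if "y \<in> S"
      by (rule inj)
        (use R x that S(1) bounded_op_on_add[OF bC] in \<open>auto simp: ell2.subspace_add\<close>)
  next
    have "norm (R y) \<le> (1 / c) * norm y" if "y \<in> S" for y
      using c(2)[of "R y"] R[OF that] c(1) by (simp add: C_def field_simps)
    then show "\<exists>K. \<forall>x\<in>S. norm (R x) \<le> K * norm x"
      by blast
  qed (use R in auto)
  then show "z \<notin> spectrum_on S A"
    using R RC by (auto simp: spectrum_on_def C_def)
qed

section \<open>Distance to the spectrum of a normal operator\<close>

text \<open>The parallelogram law turns a lower bound \<open>d c\<close> of \<open>A - w\<close> on the circle of radius \<open>c\<close> into
  the lower bound \<open>sqrt 2 d c\<^sup>2\<close> of \<open>A\<^sup>2 - w\<close> on the circle of radius \<open>c\<^sup>2\<close>: if \<open>a\<^sup>2 = w\<close>, then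
  \<open>(A - a) (A + a) x = (A + a) (A - a) x = (A\<^sup>2 - w) x\<close>, and the vectors \<open>(A + a) x\<close> and
  \<open>(A - a) x\<close> cannot both be short.  Normality keeps the lower bound of \<open>A\<close> from improving under
  squaring, so that \<open>p\<close> squarings gain the factor \<open>sqrt 2 ^ p\<close> against a fixed right-hand side.\<close>

lemma circle_lower_bound_doubling:
  assumes S: "ell2.subspace S" "closed S"
    and "normal_op_on S A" "c > 0" "d \<ge> 0" "c' \<ge> 0"
    and "\<And>x. x \<in> S \<Longrightarrow> c * norm x \<le> norm (A x)"
    and "\<And>w x. cmod w = c \<Longrightarrow> x \<in> S \<Longrightarrow> d * c * norm x \<le> norm (A x - w *\<^sub>C x)"
    and "\<exists>x\<in>S. x \<noteq> 0 \<and> norm (A x) \<le> c' * norm x"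
  shows "sqrt 2 ^ p * d * c ^ (2 ^ p) \<le> c' ^ (2 ^ p) + c ^ (2 ^ p)"
  using assms(3-)
proof (induction p arbitrary: A c d c')
  case 0
  then obtain x where x: "x \<in> S" "x \<noteq> 0" "norm (A x) \<le> c' * norm x"
    by blast
  have "d * c * norm x \<le> norm (A x - of_real c *\<^sub>C x)"
    using "0.prems"(2) x(1) by (intro "0.prems"(6)) auto
  also have "\<dots> \<le> norm (A x) + norm (of_real c *\<^sub>C x)"
    by (rule norm_triangle_ineq4)
  also have "\<dots> \<le> (c' + c) * norm x"
    using x "0.prems"(2) by (simp add: algebra_simps)
  finally show ?case
    using x by simp
next
  case (Suc p)
  note normal = Suc.prems(1) and c = Suc.prems(2) and d = Suc.prems(3) and c' = Suc.prems(4)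
    and lower = Suc.prems(5) and circle = Suc.prems(6)
  have A: "bounded_op_on S A"
    using normal by (simp add: normal_op_on_def)
  note A_in = bounded_op_on_in[OF A]
  have "sqrt 2 ^ p * (sqrt 2 * d) * (c\<^sup>2) ^ (2 ^ p) \<le> (c'\<^sup>2) ^ (2 ^ p) + (c\<^sup>2) ^ (2 ^ p)"
  proof (rule Suc.IH[of "\<lambda>x. A (A x)"])
    show "normal_op_on S (\<lambda>x. A (A x))"
      by (rule normal_op_on_square[OF normal])
    show "c\<^sup>2 * norm x \<le> norm (A (A x))" if "x \<in> S" for x
    proof -
      have "c * (c * norm x) \<le> c * norm (A x)"
        using lower[OF that] c by (intro mult_left_mono) auto
      also have "\<dots> \<le> norm (A (A x))"
        by (rule lower[OF A_in[OF that]])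
      finally show ?thesis
        by (simp add: power2_eq_square mult.assoc)
    qed
    show "sqrt 2 * d * c\<^sup>2 * norm x \<le> norm (A (A x) - w *\<^sub>C x)"
      if w: "cmod w = c\<^sup>2" and x: "x \<in> S" for w x
    proof -
      define a where "a = csqrt w"
      have a: "a * a = w" "cmod a = c"
        using w c by (simp_all add: a_def power2_eq_square[symmetric])
      define u v where "u = A x + a *\<^sub>C x" and "v = A x - a *\<^sub>C x"
      define N where "N = norm (A (A x) - w *\<^sub>C x)"
      have ax: "a *\<^sub>C x \<in> S"
        using S x by (simp add: ell2.subspace_scale)
      have uv: "u \<in> S" "v \<in> S"
        using S A_in[OF x] ax by (auto simp: u_def v_def ell2.subspace_add ell2.subspace_diff)
      have "A u - a *\<^sub>C u = A (A x) - w *\<^sub>C x"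
        unfolding u_def bounded_op_on_add[OF A A_in[OF x] ax] bounded_op_on_scaleC[OF A x]
        by (simp add: ell2.scale_right_distrib a(1))
      then have u: "d * c * norm u \<le> N"
        using circle[OF a(2) uv(1)] by (simp add: N_def)
      have "A v - (- a) *\<^sub>C v = A (A x) - w *\<^sub>C x"
        unfolding v_def bounded_op_on_diff[OF A S(1) A_in[OF x] ax] bounded_op_on_scaleC[OF A x]
        by (simp add: ell2.scale_right_diff_distrib a(1))
      then have v: "d * c * norm v \<le> N"
        using circle[of "- a", OF _ uv(2)] a(2) by (simp add: N_def)
      have "(norm u)\<^sup>2 + (norm v)\<^sup>2 = 2 * (norm (A x))\<^sup>2 + 2 * (norm (a *\<^sub>C x))\<^sup>2"
        unfolding u_def v_def norm_add_sq norm_diff_sq by simp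
      moreover have "(c * norm x)\<^sup>2 \<le> (norm (A x))\<^sup>2"
        using lower[OF x] c by (intro power_mono) auto
      ultimately have "4 * (c * norm x)\<^sup>2 \<le> (norm u)\<^sup>2 + (norm v)\<^sup>2"
        by (simp add: a(2))
      then have "(d * c)\<^sup>2 * (4 * (c * norm x)\<^sup>2) \<le> (d * c)\<^sup>2 * ((norm u)\<^sup>2 + (norm v)\<^sup>2)"
        by (rule mult_left_mono) simp
      also have "\<dots> = (d * c * norm u)\<^sup>2 + (d * c * norm v)\<^sup>2"
        by (simp add: power_mult_distrib algebra_simps)
      also have "\<dots> \<le> N\<^sup>2 + N\<^sup>2"
        using u v c d by (intro add_mono power_mono) auto
      finally have "2 * ((d * c)\<^sup>2 * (c * norm x)\<^sup>2) \<le> N\<^sup>2"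
        by simp
      then have "(sqrt 2 * d * c\<^sup>2 * norm x)\<^sup>2 \<le> N\<^sup>2"
        by (simp add: power_mult_distrib power2_eq_square mult_ac)
      then show ?thesis
        unfolding N_def by (rule power2_le_imp_le) simp
    qed
    show "\<exists>x\<in>S. x \<noteq> 0 \<and> norm (A (A x)) \<le> c'\<^sup>2 * norm x"
    proof -
      obtain y where y: "y \<in> S" "y \<noteq> 0" "norm (A y) \<le> c' * norm y"
        using Suc.prems(7) by blast
      \<comment> \<open>\<open>A\<^sup>2\<close> is tested on the preimage of \<open>y\<close>, as \<open>norm (A y) \<le> c' norm y\<close> bounds
        \<open>norm (A (A x))\<close> by \<open>c' norm (A x)\<close>, where \<open>norm (A x)\<close> is at most the geometric mean of
        \<open>norm (A (A x))\<close> and \<open>norm x\<close>.\<close>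
      obtain x where x: "x \<in> S" "A x = y"
        using normal_bounded_below_surj[OF normal S c lower y(1)] by blast
      have "(norm (A (A x)))\<^sup>2 \<le> (c' * norm (A x))\<^sup>2"
        using y x by (intro power_mono) auto
      also have "\<dots> \<le> c'\<^sup>2 * (norm (A (A x)) * norm x)"
        using normal_norm_sq_le[OF normal x(1)] by (simp add: power_mult_distrib mult_left_mono)
      finally have sq: "norm (A (A x)) * norm (A (A x)) \<le> norm (A (A x)) * (c'\<^sup>2 * norm x)"
        by (simp add: power2_eq_square mult_ac)
      have "A x \<noteq> 0" "x \<noteq> 0"
        using x y bounded_op_on_scaleC[OF A, of 0 0] by auto
      moreover have "norm (A (A x)) > 0"
        using lower[OF y(1)] c y(2) x(2) by (smt (verit) mult_pos_pos zero_less_norm_iff)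
      ultimately show ?thesis
        using sq x by auto
    qed
  qed (use c d c' in auto)
  then show ?case
    by (simp add: power_mult[symmetric] mult_ac)
qed

text \<open>If the circle missed the spectrum, then \<open>A - w\<close> would be bounded below uniformly over the
  circle by compactness, and enough squarings would violate the previous inequality.\<close>

theorem spectrum_meets_circle_of_minimum_modulus:
  assumes S: "ell2.subspace S" "closed S" and A: "normal_op_on S A"
    and c: "c \<ge> 0" and lower: "\<And>x. x \<in> S \<Longrightarrow> c * norm x \<le> norm (A x)"
    and sharp: "\<And>c'. c' > c \<Longrightarrow> \<exists>x\<in>S. x \<noteq> 0 \<and> norm (A x) \<le> c' * norm x"
  shows "\<exists>w\<in>spectrum_on S A. cmod w = c"
proof (rule ccontr)
  assume contra: "\<not> ?thesis"
  have off: "\<exists>e>0. \<forall>x\<in>S. e * norm x \<le> norm (A x - w *\<^sub>C x)" if "cmod w = c" for w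
    using not_in_spectrum_iff_bounded_below[OF A S] that contra by blast
  show False
  proof (cases "c = 0")
    case True
    then obtain e where e: "e > 0" "\<And>x. x \<in> S \<Longrightarrow> e * norm x \<le> norm (A x)"
      using off[of 0] by auto
    then obtain x where "x \<in> S" "x \<noteq> 0" "norm (A x) \<le> e / 2 * norm x"
      using sharp[of "e / 2"] True by auto
    with e(2)[of x] have "e * norm x \<le> e / 2 * norm x"
      by linarith
    then show False
      using e(1) \<open>x \<noteq> 0\<close> by simp
  next
    case False
    with c have c: "c > 0"
      by simp
    have "\<exists>e>0. \<forall>w x. cmod w = c \<longrightarrow> x \<in> S \<longrightarrow> e * norm x \<le> norm (A x - w *\<^sub>C x)"
    proof (rule ccontr)
      assume no: "\<not> ?thesis"
      have "\<exists>w x. cmod w = c \<and> x \<in> S \<and> norm (A x - w *\<^sub>C x) < inverse (real (Suc j)) * norm x"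
        for j
      proof -
        have "\<not> (\<forall>w x. cmod w = c \<longrightarrow> x \<in> S \<longrightarrow>
            inverse (real (Suc j)) * norm x \<le> norm (A x - w *\<^sub>C x))"
          using no inverse_positive_iff_positive of_nat_0_less_iff zero_less_Suc by blast
        then show ?thesis
          by (auto simp: not_le)
      qed
      then obtain W X where WX: "\<And>j. cmod (W j) = c" "\<And>j. X j \<in> S"
        "\<And>j. norm (A (X j) - W j *\<^sub>C X j) < inverse (real (Suc j)) * norm (X j)"
        by metis
      have "\<forall>j. W j \<in> sphere 0 c"
        using WX by simp
      then obtain l r where l: "l \<in> sphere 0 c" "strict_mono r" "(W \<circ> r) \<longlonglongrightarrow> l"
        using compact_sphere[of "0 :: complex" c] unfolding compact_def by metis
      then obtain e where e: "e > 0" "\<And>x. x \<in> S \<Longrightarrow> e * norm x \<le> norm (A x - l *\<^sub>C x)"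
        using off[of l] by auto
      have "\<forall>\<^sub>F j in sequentially. dist ((W \<circ> r) j) l < e / 2"
        using e(1) by (intro tendstoD[OF l(3)]) simp
      moreover have "\<forall>\<^sub>F j in sequentially. inverse (real (Suc j)) < e / 2"
        using e(1) by (intro order_tendstoD(2)[OF LIMSEQ_inverse_real_of_nat]) simp
      ultimately have "\<forall>\<^sub>F j in sequentially.
          dist ((W \<circ> r) j) l < e / 2 \<and> inverse (real (Suc j)) < e / 2"
        by (rule eventually_conj)
      then obtain j where j: "dist (W (r j)) l < e / 2" "inverse (real (Suc j)) < e / 2"
        by (auto simp: eventually_sequentially)
      define x w where "x = X (r j)" and "w = W (r j)"
      have "j \<le> r j"
        by (rule seq_suble[OF l(2)])
      then have "inverse (real (Suc (r j))) \<le> inverse (real (Suc j))"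
        by (intro le_imp_inverse_le) auto
      then have "inverse (real (Suc (r j))) \<le> e / 2"
        using j(2) by linarith
      then have "inverse (real (Suc (r j))) * norm x \<le> e / 2 * norm x"
        by (rule mult_right_mono) simp
      then have 1: "norm (A x - w *\<^sub>C x) < e / 2 * norm x"
        using WX(3)[of "r j"] by (simp add: x_def w_def)
      have 2: "norm ((w - l) *\<^sub>C x) \<le> e / 2 * norm x"
        using mult_right_mono[of "cmod (w - l)" "e / 2" "norm x"] j(1) by (simp add: w_def dist_norm)
      have eq: "A x - l *\<^sub>C x = (A x - w *\<^sub>C x) + (w - l) *\<^sub>C x"
        by (simp add: ell2.scale_left_diff_distrib)
      have "norm (A x - l *\<^sub>C x) < e / 2 * norm x + e / 2 * norm x"
        unfolding eq using 1 2 norm_triangle_ineq[of "A x - w *\<^sub>C x" "(w - l) *\<^sub>C x"]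
        by linarith
      also have "\<dots> \<le> norm (A x - l *\<^sub>C x)"
        using e(2)[of x] WX(2) by (simp add: x_def)
      finally show False
        by simp
    qed
    then obtain e where e: "e > 0"
      "\<And>w x. cmod w = c \<Longrightarrow> x \<in> S \<Longrightarrow> e * norm x \<le> norm (A x - w *\<^sub>C x)"
      by blast
    define d where "d = e / c"
    have d: "d > 0" "d * c = e"
      using c e(1) by (auto simp: d_def)
    obtain p where p: "3 / d < sqrt 2 ^ p"
      using real_arch_pow[of "sqrt 2" "3 / d"] by auto
    \<comment> \<open>\<open>c'\<close> exceeds \<open>c\<close> so little that its power of exponent \<open>2 ^ p\<close> is twice that of \<open>c\<close>.\<close>
    define c' where "c' = root (2 ^ p) 2 * c"
    have c': "c' ^ (2 ^ p) = 2 * c ^ (2 ^ p)" "c' > c"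
      using c by (auto simp: c'_def power_mult_distrib)
    have "sqrt 2 ^ p * d * c ^ (2 ^ p) \<le> c' ^ (2 ^ p) + c ^ (2 ^ p)"
      using sharp[OF c'(2)] d e(2) c c'(2)
      by (intro circle_lower_bound_doubling[OF S A c _ _ lower]) auto
    then have "sqrt 2 ^ p * d * c ^ (2 ^ p) \<le> 3 * c ^ (2 ^ p)"
      by (simp add: c'(1))
    then have "sqrt 2 ^ p * d \<le> 3"
      using c by simp
    then show False
      using p d(1) by (simp add: field_simps)
  qed
qed

lemma spectrum_on_shift:
  "w \<in> spectrum_on S (\<lambda>x. A x - z *\<^sub>C x) \<longleftrightarrow> z + w \<in> spectrum_on S A"
  by (simp add: spectrum_on_def ell2.scale_left_distrib diff_diff_eq)

text \<open>An approximate eigenvalue of a normal operator lies as close to the spectrum as the defect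
  suggests: the infimum of \<open>norm (A x - z x) / norm x\<close> is the modulus of a point of the spectrum of
  \<open>A - z\<close>.\<close>

corollary spectrum_near_approx_eigenvalue:
  assumes S: "ell2.subspace S" "closed S" and A: "normal_op_on S A"
    and x: "x \<in> S" "x \<noteq> 0" "norm (A x - z *\<^sub>C x) \<le> e * norm x"
  shows "\<exists>w\<in>spectrum_on S A. cmod (w - z) \<le> e"
proof -
  define C where "C x = A x - z *\<^sub>C x" for x
  have C: "normal_op_on S C"
    using normal_op_on_shift[OF A S(1), of z] by (simp add: C_def[abs_def])
  define Q where "Q = (\<lambda>x. norm (C x) / norm x) ` (S - {0})"
  have Q: "Q \<noteq> {}" "bdd_below Q"
    using x by (auto simp: Q_def intro!: bdd_belowI[of _ 0])
  define c where "c = Inf Q"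
  have c: "c \<ge> 0"
    unfolding c_def using Q(1) by (rule cInf_greatest) (auto simp: Q_def)
  have lower: "c * norm y \<le> norm (C y)" if "y \<in> S" for y
  proof (cases "y = 0")
    case False
    then have "c \<le> norm (C y) / norm y"
      unfolding c_def using that Q(2) by (intro cInf_lower) (auto simp: Q_def)
    then show ?thesis
      using False by (simp add: field_simps)
  qed simp
  have "\<exists>y\<in>S. y \<noteq> 0 \<and> norm (C y) \<le> c' * norm y" if c': "c < c'" for c'
  proof -
    obtain q where "q \<in> Q" "q < c'"
      using cInf_lessD[OF Q(1) c'[unfolded c_def]] by blast
    then show ?thesis
      by (auto simp: Q_def field_simps intro!: bexI less_imp_le)
  qed
  then obtain w where w: "w \<in> spectrum_on S C" "cmod w = c"
    using spectrum_meets_circle_of_minimum_modulus[OF S C c lower] by blast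
  have "c * norm x \<le> e * norm x"
    using lower[OF x(1)] x(3) by (simp add: C_def)
  then have "c \<le> e"
    using x(2) by simp
  moreover have "z + w \<in> spectrum_on S A"
    using w(1) spectrum_on_shift[of w S A z] by (simp add: C_def[abs_def])
  ultimately show ?thesis
    using w(2) by (intro bexI[of _ "z + w"]) auto
qed

section \<open>Initial segments and tails of sequences\<close>

definition tail_space :: "nat \<Rightarrow> ell2 set" where
  "tail_space n = {x. \<forall>k<n. coord x k = 0}"

definition head :: "nat \<Rightarrow> ell2 \<Rightarrow> ell2" where
  "head n x = (\<Sum>k<n. coord x k *\<^sub>C ell2_basis k)"

lemma coord_sum: "coord (sum f I) k = (\<Sum>i\<in>I. coord (f i) k)"
  by (induction I rule: infinite_finite_induct) (simp_all add: coord_simps)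

lemma coord_head: "coord (head n x) k = (if k < n then coord x k else 0)"
  by (simp add: head_def coord_sum coord_simps if_distrib cong: if_cong)

lemma subspace_tail_space: "ell2.subspace (tail_space n)"
  by (simp add: tail_space_def ell2.subspace_def coord_simps)

lemma closed_tail_space: "closed (tail_space n)"
  unfolding closed_sequential_limits
proof (intro allI impI)
  fix X l
  assume X: "(\<forall>i. X i \<in> tail_space n) \<and> X \<longlonglongrightarrow> l"
  have "coord l k = 0" if "k < n" for k
  proof (rule LIMSEQ_unique)
    show "(\<lambda>i. coord (X i) k) \<longlonglongrightarrow> coord l k"
      using X tendsto_coord by blast
    show "(\<lambda>i. coord (X i) k) \<longlonglongrightarrow> 0"
      using X that by (simp add: tail_space_def)
  qed
  then show "l \<in> tail_space n"
    by (simp add: tail_space_def)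
qed

lemma tail_space_antimono: "m \<le> n \<Longrightarrow> tail_space n \<subseteq> tail_space m"
  by (auto simp: tail_space_def)

lemma tail_space_0: "tail_space 0 = UNIV"
  by (simp add: tail_space_def)

lemma diff_head_in_tail_space: "x - head n x \<in> tail_space n"
  by (simp add: tail_space_def coord_simps coord_head)

lemma head_in_tail_space: "x \<in> tail_space n \<Longrightarrow> head m x \<in> tail_space n"
  by (simp add: tail_space_def coord_head)

lemma ell2_n_eq: "ell2_n n = {x. \<forall>k\<ge>n. coord x k = 0}"
proof
  show "ell2_n n \<subseteq> {x. \<forall>k\<ge>n. coord x k = 0}"
    unfolding ell2_n_def
    by (rule ell2.span_minimal) (auto simp: ell2.subspace_def coord_simps)
  show "{x. \<forall>k\<ge>n. coord x k = 0} \<subseteq> ell2_n n"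
  proof
    fix x
    assume "x \<in> {x. \<forall>k\<ge>n. coord x k = 0}"
    then have "x = head n x"
      by (auto simp: ell2_eq_iff coord_head)
    also have "head n x \<in> ell2_n n"
      unfolding head_def ell2_n_def
      by (intro ell2.span_sum ell2.span_scale ell2.span_base) auto
    finally show "x \<in> ell2_n n" .
  qed
qed

lemma head_in_ell2_n: "head n x \<in> ell2_n n"
  by (simp add: ell2_n_eq coord_head)

lemma ell2_n_mono: "m \<le> n \<Longrightarrow> ell2_n m \<subseteq> ell2_n n"
  by (auto simp: ell2_n_eq)

lemma subspace_ell2_n: "ell2.subspace (ell2_n n)"
  by (simp add: ell2_n_def ell2.subspace_span)

lemma closed_ell2_n: "closed (ell2_n n)"
  unfolding closed_sequential_limits
proof (intro allI impI)
  fix X l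
  assume X: "(\<forall>i. X i \<in> ell2_n n) \<and> X \<longlonglongrightarrow> l"
  have "coord l k = 0" if "k \<ge> n" for k
  proof (rule LIMSEQ_unique)
    show "(\<lambda>i. coord (X i) k) \<longlonglongrightarrow> coord l k"
      using X tendsto_coord by blast
    show "(\<lambda>i. coord (X i) k) \<longlonglongrightarrow> 0"
      using X that by (simp add: ell2_n_eq)
  qed
  then show "l \<in> ell2_n n"
    by (simp add: ell2_n_eq)
qed

lemma cinner_eq_0_if_disjoint:
  assumes "\<And>k. coord x k = 0 \<or> coord y k = 0"
  shows "cinner x y = 0"
proof -
  have "coord x k * cnj (coord y k) = 0" for k
    using assms[of k] by auto
  then show ?thesis
    by (simp only: cinner_def suminf_zero)
qed

lemma orth_compl_ell2_n: "orth_compl (ell2_n n) = tail_space n"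
proof
  show "orth_compl (ell2_n n) \<subseteq> tail_space n"
    by (auto simp: orth_compl_def tail_space_def coord_eq_cinner ell2_n_def intro: ell2.span_base)
  show "tail_space n \<subseteq> orth_compl (ell2_n n)"
    by (auto simp: orth_compl_def tail_space_def ell2_n_eq intro!: cinner_eq_0_if_disjoint)
      (meson not_le)
qed

lemma extend_zero_ell2_n: "extend_zero (ell2_n n) A x = A (head n x)"
proof -
  have "(THE s. s \<in> ell2_n n \<and> x - s \<in> orth_compl (ell2_n n)) = head n x"
  proof (rule the_equality)
    show "head n x \<in> ell2_n n \<and> x - head n x \<in> orth_compl (ell2_n n)"
      by (simp add: head_in_ell2_n orth_compl_ell2_n diff_head_in_tail_space)
    fix s
    assume "s \<in> ell2_n n \<and> x - s \<in> orth_compl (ell2_n n)"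
    then have "\<forall>k\<ge>n. coord s k = 0" "\<forall>k<n. coord x k - coord s k = 0"
      unfolding orth_compl_ell2_n by (auto simp: tail_space_def ell2_n_eq coord_simps)
    then have "coord s k = coord (head n x) k" for k
      by (cases "k < n") (auto simp: coord_head)
    then show "s = head n x"
      by (simp add: ell2_eq_iff)
  qed
  then show ?thesis
    by (simp add: extend_zero_def)
qed

lemma head_tendsto: "(\<lambda>n. head n x) \<longlonglongrightarrow> x"
proof -
  have "(norm (x - head n x))\<^sup>2 = (\<Sum>i. (cmod (coord x (i + n)))\<^sup>2)" for n
    unfolding norm_ell2_sq suminf_split_initial_segment[OF summable_coord, of "x - head n x" n]
    by (simp add: coord_simps coord_head)
  then have "(\<lambda>n. (norm (x - head n x))\<^sup>2) \<longlonglongrightarrow> 0"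
    using suminf_exist_split2[OF summable_coord] by simp
  then have "(\<lambda>n. sqrt ((norm (x - head n x))\<^sup>2)) \<longlonglongrightarrow> sqrt 0"
    by (rule tendsto_real_sqrt)
  then have "(\<lambda>n. x - head n x) \<longlonglongrightarrow> 0"
    by (simp add: tendsto_norm_zero_iff)
  then have "(\<lambda>n. x - (x - head n x)) \<longlonglongrightarrow> x - 0"
    by (intro tendsto_intros)
  then show ?thesis
    by simp
qed

text \<open>Elimination of the coordinates \<open>m - 1, ..., 0\<close>, each at the cost of at most one spanning
  vector.\<close>

lemma finite_span_if_no_tail:
  assumes "ell2.subspace U" "\<And>x. x \<in> U \<Longrightarrow> x \<in> tail_space m \<Longrightarrow> x = 0"
  shows "\<exists>F. finite F \<and> U = ell2.span F"
  using assms
proof (induction m arbitrary: U)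
  case 0
  then have "U = ell2.span {}"
    using ell2.subspace_0[of U] by (auto simp: tail_space_0)
  then show ?case
    by blast
next
  case (Suc m)
  define V where "V = {x \<in> U. coord x m = 0}"
  have "ell2.subspace V"
    using Suc.prems(1) by (auto simp: V_def ell2.subspace_def coord_simps)
  moreover have "x = 0" if "x \<in> V" "x \<in> tail_space m" for x
    using that Suc.prems(2)[of x] by (auto simp: V_def tail_space_def less_Suc_eq)
  ultimately obtain F where F: "finite F" "V = ell2.span F"
    using Suc.IH[of V] by blast
  show ?case
  proof (cases "U = V")
    case False
    then obtain a where a: "a \<in> U" "coord a m \<noteq> 0"
      by (auto simp: V_def)
    have "U = ell2.span (insert a F)"
    proof
      show "U \<subseteq> ell2.span (insert a F)"
      proof
        fix x
        assume "x \<in> U"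
        then have "x - (coord x m / coord a m) *\<^sub>C a \<in> V"
          using a Suc.prems(1)
          by (simp add: V_def ell2.subspace_diff ell2.subspace_scale coord_simps)
        then show "x \<in> ell2.span (insert a F)"
          unfolding ell2.span_breakdown_eq F(2) by blast
      qed
      have "F \<subseteq> U"
        using F(2) ell2.span_superset[of F] by (auto simp: V_def)
      then show "ell2.span (insert a F) \<subseteq> U"
        using a Suc.prems(1) by (intro ell2.span_minimal) auto
    qed
    then show ?thesis
      using F(1) by blast
  qed (use F in blast)
qed

lemma finite_span_projection:
  assumes "finite F"
  shows "\<exists>P. \<forall>x. P x \<in> ell2.span F \<and> (\<forall>u\<in>ell2.span F. cinner (x - P x) u = 0)"
  using assms
proof induction
  case empty
  show ?case
    by (rule exI[of _ "\<lambda>_. 0"]) simp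
next
  case (insert a F)
  then obtain P where P: "\<And>x. P x \<in> ell2.span F"
    "\<And>x u. u \<in> ell2.span F \<Longrightarrow> cinner (x - P x) u = 0"
    by metis
  define b where "b = a - P a"
  \<comment> \<open>A Gram--Schmidt step.  If \<open>b = 0\<close>, then \<open>c x = 0\<close> by division by zero, as it should be.\<close>
  define c where "c x = cinner (x - P x) b / cinner b b" for x
  have sub: "ell2.span F \<subseteq> ell2.span (insert a F)"
    by (rule ell2.span_mono) auto
  then have b: "b \<in> ell2.span (insert a F)"
    unfolding b_def using P(1)[of a] by (intro ell2.span_diff) (auto intro: ell2.span_base)
  have Pb: "cinner (x - P x - c x *\<^sub>C b) b = 0" for x
    by (cases "b = 0") (simp_all add: c_def cinner_diff_left[of _ "_ *\<^sub>C _"] cinner_scaleC_left cinner_self)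
  have "cinner (x - (P x + c x *\<^sub>C b)) u = 0" if u: "u \<in> ell2.span (insert a F)" for x u
  proof -
    obtain k where k: "u - k *\<^sub>C a \<in> ell2.span F"
      using u unfolding ell2.span_breakdown_eq by blast
    define v where "v = (u - k *\<^sub>C a) + k *\<^sub>C P a"
    have v: "v \<in> ell2.span F"
      unfolding v_def using k P(1) by (intro ell2.span_add ell2.span_scale)
    have u_eq: "u = v + k *\<^sub>C b"
      by (simp add: v_def b_def ell2.scale_right_diff_distrib)
    have "cinner (x - P x) v = 0" "cinner b v = 0"
      using P(2)[OF v] by (auto simp: b_def)
    then have "cinner (x - P x - c x *\<^sub>C b) v = 0"
      by (simp add: cinner_diff_left[of _ "_ *\<^sub>C _"] cinner_scaleC_left)
    then show ?thesis
      using Pb[of x] by (simp add: u_eq cinner_add_right cinner_scaleC_right diff_diff_eq)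
  qed
  moreover have "P x + c x *\<^sub>C b \<in> ell2.span (insert a F)" for x
    using P(1)[of x] sub b by (intro ell2.span_add ell2.span_scale) auto
  ultimately show ?case
    by (intro exI[of _ "\<lambda>x. P x + c x *\<^sub>C b"]) auto
qed

text \<open>The vectors far out are almost orthogonal to a finite-dimensional space, uniformly over its
  unit ball.  Splitting off one dimension orthogonally at a time bounds the components of \<open>u\<close> by
  \<open>norm u\<close>, and each of the finitely many directions is almost exhausted by an initial segment.\<close>

lemma tail_almost_orthogonal_finite_span:
  assumes "finite F" "e > 0"
  shows "\<exists>m. \<forall>x\<in>tail_space m. \<forall>u\<in>ell2.span F. cmod (cinner x u) \<le> e * norm x * norm u"
  using assms
proof (induction arbitrary: e)
  case empty
  then show ?case
    by simp
next
  case (insert a F)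
  obtain P where P: "\<And>x. P x \<in> ell2.span F"
    "\<And>x u. u \<in> ell2.span F \<Longrightarrow> cinner (x - P x) u = 0"
    using finite_span_projection[OF insert.hyps(1)] by metis
  define b where "b = a - P a"
  obtain m1 where m1: "\<And>x u. x \<in> tail_space m1 \<Longrightarrow> u \<in> ell2.span F \<Longrightarrow>
      cmod (cinner x u) \<le> e / 2 * norm x * norm u"
    using insert.IH[of "e / 2"] insert.prems by auto
  obtain m2 where m2: "norm (b - head m2 b) \<le> e / 2 * norm b"
  proof (cases "b = 0")
    case True
    then show ?thesis
      using that[of 0] by (simp add: head_def)
  next
    case False
    then have "\<forall>\<^sub>F m in sequentially. dist (head m b) b < e / 2 * norm b"
      using insert.prems by (intro tendstoD[OF head_tendsto]) auto
    then obtain m where "dist (head m b) b < e / 2 * norm b"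
      unfolding eventually_sequentially by blast
    then show ?thesis
      using that[of m] by (simp add: dist_norm norm_minus_commute)
  qed
  have "cmod (cinner x u) \<le> e * norm x * norm u"
    if x: "x \<in> tail_space (max m1 m2)" and u: "u \<in> ell2.span (insert a F)" for x u
  proof -
    obtain k where k: "u - k *\<^sub>C a \<in> ell2.span F"
      using u unfolding ell2.span_breakdown_eq by blast
    define v where "v = (u - k *\<^sub>C a) + k *\<^sub>C P a"
    have v: "v \<in> ell2.span F"
      unfolding v_def using k P(1) by (intro ell2.span_add ell2.span_scale)
    have u_eq: "u = v + k *\<^sub>C b"
      by (simp add: v_def b_def ell2.scale_right_diff_distrib)
    have "cinner b v = 0"
      using P(2)[OF v] by (simp add: b_def)
    then have "cinner v b = 0"
      by (metis cinner_commute complex_cnj_zero)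
    then have "(norm u)\<^sup>2 = (norm v)\<^sup>2 + (norm (k *\<^sub>C b))\<^sup>2"
      unfolding u_eq norm_add_sq by (simp add: cinner_scaleC_right)
    then have "(norm v)\<^sup>2 \<le> (norm u)\<^sup>2" "(norm (k *\<^sub>C b))\<^sup>2 \<le> (norm u)\<^sup>2"
      by auto
    then have le: "norm v \<le> norm u" "norm (k *\<^sub>C b) \<le> norm u"
      using power2_le_imp_le norm_ge_zero by blast+
    have x1: "x \<in> tail_space m1" and x2: "x \<in> tail_space m2"
      using x by (auto simp: tail_space_def)
    have "cinner x (head m2 b) = 0"
      using x2 by (intro cinner_eq_0_if_disjoint) (auto simp: coord_head tail_space_def)
    then have "cmod (cinner x b) = cmod (cinner x (b - head m2 b))"
      by (simp add: cinner_diff_right)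
    also have "\<dots> \<le> norm x * norm (b - head m2 b)"
      by (rule cinner_le_norm)
    also have "\<dots> \<le> norm x * (e / 2 * norm b)"
      using m2 by (intro mult_left_mono) auto
    finally have "cmod k * cmod (cinner x b) \<le> cmod k * (norm x * (e / 2 * norm b))"
      by (intro mult_left_mono) auto
    then have b: "cmod (cinner x (k *\<^sub>C b)) \<le> e / 2 * norm x * norm (k *\<^sub>C b)"
      by (simp add: cinner_scaleC_right norm_mult mult_ac)
    have "cmod (cinner x u) \<le> cmod (cinner x v) + cmod (cinner x (k *\<^sub>C b))"
      unfolding u_eq cinner_add_right by (rule norm_triangle_ineq)
    also have "\<dots> \<le> e / 2 * norm x * norm v + e / 2 * norm x * norm (k *\<^sub>C b)"
      using m1[OF x1 v] b by linarith
    also have "\<dots> \<le> e / 2 * norm x * norm u + e / 2 * norm x * norm u"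
      using le insert.prems by (intro add_mono mult_left_mono) auto
    finally show ?thesis
      by (simp add: mult_ac)
  qed
  then show ?case
    by (intro exI[of _ "max m1 m2"]) simp
qed

lemma bounded_imp_coord_convergent_subseq:
  assumes "\<And>j. norm (X j) \<le> b"
  shows "\<exists>r :: nat \<Rightarrow> nat. strict_mono r \<and> (\<forall>k<m. convergent (\<lambda>j. coord (X (r j)) k))"
proof (induction m)
  case 0
  show ?case
    by (auto intro!: exI[of _ id] simp: strict_mono_def)
next
  case (Suc m)
  then obtain r :: "nat \<Rightarrow> nat" where r: "strict_mono r"
    "\<And>k. k < m \<Longrightarrow> convergent (\<lambda>j. coord (X (r j)) k)"
    by blast
  have "cmod (coord (X (r j)) m) \<le> b" for j
    using coord_le_norm[of "X (r j)" m] assms[of "r j"] by linarith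
  then have "\<forall>j. coord (X (r j)) m \<in> cball 0 b"
    by simp
  then obtain l s where s: "strict_mono s" "((\<lambda>j. coord (X (r j)) m) \<circ> s) \<longlonglongrightarrow> l"
    using compact_cball[of "0 :: complex" b] unfolding compact_def by metis
  have "convergent (\<lambda>j. coord (X ((r \<circ> s) j)) k)" if "k < Suc m" for k
  proof (cases "k = m")
    case True
    then show ?thesis
      using s(2) by (auto simp: convergent_def o_def)
  next
    case False
    then have "convergent ((\<lambda>j. coord (X (r j)) k) \<circ> s)"
      using that r(2)[of k] s(1) by (intro convergent_subseq_convergent) auto
    then show ?thesis
      by (simp add: o_def)
  qed
  then show ?case
    by (intro exI[of _ "r \<circ> s"] conjI strict_mono_o[OF r(1) s(1)]) auto
qed

section \<open>The essential spectrum of a normal operator\<close>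

text \<open>The first \<open>m\<close> coordinates converge along a subsequence by compactness, and the remaining parts
  of the \<open>X j\<close>, on which \<open>C\<close> is bounded below, then form a Cauchy sequence because their images
  converge.\<close>

lemma approx_kernel_convergent_subseq:
  assumes C: "bounded_op_on (tail_space n) C" and m: "n \<le> m"
    and c: "c > 0" "\<forall>x\<in>tail_space m. c * norm x \<le> norm (C x)"
    and X: "\<And>j. X j \<in> tail_space n" "\<And>j. norm (X j) = 1" "(\<lambda>j. C (X j)) \<longlonglongrightarrow> 0"
  shows "\<exists>r x. strict_mono (r :: nat \<Rightarrow> nat) \<and> x \<in> tail_space n \<and> (X \<circ> r) \<longlonglongrightarrow> x \<and> C x = 0"
proof -
  note S = subspace_tail_space[of n]
  obtain r :: "nat \<Rightarrow> nat" where r: "strict_mono r"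
    "\<And>k. k < m \<Longrightarrow> convergent (\<lambda>j. coord (X (r j)) k)"
    using bounded_imp_coord_convergent_subseq[of X 1 m] X(2) by auto
  then obtain l where l: "\<And>k. k < m \<Longrightarrow> (\<lambda>j. coord (X (r j)) k) \<longlonglongrightarrow> l k"
    unfolding convergent_def by metis
  define H where "H j = head m (X (r j))" for j
  have H_in: "H j \<in> tail_space n" for j
    by (simp add: H_def head_in_tail_space X(1))
  define h where "h = (\<Sum>k<m. l k *\<^sub>C ell2_basis k)"
  have H: "H \<longlonglongrightarrow> h"
    unfolding H_def head_def h_def by (intro tendsto_sum tendsto_scaleC_left l) simp
  have h_in: "h \<in> tail_space n"
    using closed_sequentially[OF closed_tail_space _ H] H_in by blast
  define t where "t j = X (r j) - H j" for j
  have t_m: "t j \<in> tail_space m" for j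
    by (simp add: t_def H_def diff_head_in_tail_space)
  then have t_n: "t j \<in> tail_space n" for j
    using tail_space_antimono[OF m] by blast
  have "C (t j) = C (X (r j)) - C (H j)" for j
    unfolding t_def by (rule bounded_op_on_diff[OF C S X(1) H_in])
  moreover have "(\<lambda>j. C (X (r j))) \<longlonglongrightarrow> 0"
    using LIMSEQ_subseq_LIMSEQ[OF X(3) r(1)] by (simp add: o_def)
  ultimately have "(\<lambda>j. C (t j)) \<longlonglongrightarrow> 0 - C h"
    by (simp only:) (intro tendsto_diff bounded_op_on_tendsto[OF C S H_in h_in H])
  then have Ct: "Cauchy (\<lambda>j. C (t j))"
    by (rule LIMSEQ_imp_Cauchy)
  have "Cauchy t"
    unfolding Cauchy_def
  proof (intro allI impI)
    fix e :: real
    assume "e > 0"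
    then obtain M where M: "\<And>i j. i \<ge> M \<Longrightarrow> j \<ge> M \<Longrightarrow> dist (C (t i)) (C (t j)) < c * e"
      using Ct c(1) unfolding Cauchy_def by (meson mult_pos_pos)
    have "dist (t i) (t j) < e" if "i \<ge> M" "j \<ge> M" for i j
    proof -
      have "c * norm (t i - t j) \<le> norm (C (t i - t j))"
        by (intro c(2)[rule_format] ell2.subspace_diff subspace_tail_space t_m)
      also have "\<dots> < c * e"
        using M[OF that] by (simp add: bounded_op_on_diff[OF C S t_n t_n] dist_norm)
      finally show ?thesis
        using c(1) by (simp add: dist_norm)
    qed
    then show "\<exists>M. \<forall>i\<ge>M. \<forall>j\<ge>M. dist (t i) (t j) < e"
      by blast
  qed
  then obtain t0 where "t \<longlonglongrightarrow> t0"
    using Cauchy_convergent_iff convergent_def by blast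
  then have "(\<lambda>j. t j + H j) \<longlonglongrightarrow> t0 + h"
    by (intro tendsto_add H)
  then have lim: "(X \<circ> r) \<longlonglongrightarrow> t0 + h"
    by (simp add: t_def o_def)
  have x_in: "t0 + h \<in> tail_space n"
    using closed_sequentially[OF closed_tail_space _ lim] X(1) by simp
  have "(\<lambda>j. C ((X \<circ> r) j)) \<longlonglongrightarrow> C (t0 + h)"
    by (rule bounded_op_on_tendsto[OF C S _ x_in lim]) (simp add: X(1))
  then have "C (t0 + h) = 0"
    using LIMSEQ_subseq_LIMSEQ[OF X(3) r(1)] LIMSEQ_unique by (fastforce simp: o_def)
  then show ?thesis
    using r(1) x_in lim by blast
qed

lemma spectrum_unit_approx_eigenvector:
  assumes A: "normal_op_on S A" and S: "ell2.subspace S" "closed S"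
    and z: "z \<in> spectrum_on S A" and e: "e > 0"
  shows "\<exists>x\<in>S. norm x = 1 \<and> norm (A x - z *\<^sub>C x) < e"
proof -
  obtain y where y: "y \<in> S" "norm (A y - z *\<^sub>C y) < e * norm y"
    using not_in_spectrum_iff_bounded_below[OF A S, of z] z e by (auto simp: not_le)
  then have y0: "norm y > 0"
    using e norm_ge_zero[of "A y - z *\<^sub>C y"] by (metis le_less_trans zero_less_mult_pos)
  define a where "a = complex_of_real (1 / norm y)"
  have bA: "bounded_op_on S A"
    using A by (simp add: normal_op_on_def)
  have eq: "A (a *\<^sub>C y) - z *\<^sub>C (a *\<^sub>C y) = a *\<^sub>C (A y - z *\<^sub>C y)"
    unfolding bounded_op_on_scaleC[OF bA y(1)] by (simp add: ell2.scale_right_diff_distrib mult.commute)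
  have "norm (A (a *\<^sub>C y) - z *\<^sub>C (a *\<^sub>C y)) < e"
    unfolding eq norm_scaleC using y y0 by (simp add: a_def norm_divide field_simps)
  moreover have "norm (a *\<^sub>C y) = 1"
    using y0 by (simp add: a_def norm_divide)
  ultimately show ?thesis
    using y(1) S(1) by (intro bexI[of _ "a *\<^sub>C y"]) (auto simp: ell2.subspace_scale)
qed

lemma bounded_below_on_tail_imp_finite_eigenspace:
  assumes A: "bounded_op_on (tail_space n) A"
    and c: "c > 0" "\<forall>x\<in>tail_space m. c * norm x \<le> norm (A x - z *\<^sub>C x)"
  shows "\<exists>F. finite F \<and> eigenspace_on (tail_space n) A z = ell2.span F"
proof (rule finite_span_if_no_tail[where m = m])
  have "A 0 = 0"
    using bounded_op_on_scaleC[OF A, of 0 0] ell2.subspace_0[OF subspace_tail_space] by simp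
  then show "ell2.subspace (eigenspace_on (tail_space n) A z)"
    using subspace_tail_space[of n] A
    by (auto simp: eigenspace_on_def ell2.subspace_def bounded_op_on_def
        ell2.scale_right_distrib mult.commute)
  show "x = 0" if "x \<in> eigenspace_on (tail_space n) A z" "x \<in> tail_space m" for x
    using c(1) bspec[OF c(2) that(2)] that(1) by (auto simp: eigenspace_on_def mult_le_0_iff)
qed

lemma bounded_below_on_tail_imp_eigenvalue:
  assumes A: "normal_op_on (tail_space n) A" and m: "n \<le> m"
    and c: "c > 0" "\<forall>x\<in>tail_space m. c * norm x \<le> norm (A x - z *\<^sub>C x)"
    and z: "z \<in> spectrum_on (tail_space n) A"
  shows "eigenspace_on (tail_space n) A z \<noteq> {0}"
proof -
  note S = subspace_tail_space[of n] closed_tail_space[of n]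
  have C: "bounded_op_on (tail_space n) (\<lambda>x. A x - z *\<^sub>C x)"
    using normal_op_on_shift[OF A S(1), of z] by (simp add: normal_op_on_def)
  have "\<exists>x\<in>tail_space n. norm x = 1 \<and> norm (A x - z *\<^sub>C x) < inverse (real (Suc j))" for j
    by (rule spectrum_unit_approx_eigenvector[OF A S z]) simp
  then obtain X where X: "\<And>j. X j \<in> tail_space n" "\<And>j. norm (X j) = 1"
    "\<And>j. norm (A (X j) - z *\<^sub>C X j) < inverse (real (Suc j))"
    by metis
  have "(\<lambda>j. A (X j) - z *\<^sub>C X j) \<longlonglongrightarrow> 0"
    using X(3) by (intro Lim_null_comparison[OF _ LIMSEQ_inverse_real_of_nat] eventuallyI)
      (auto intro: less_imp_le)
  then obtain r x where x: "x \<in> tail_space n" "(X \<circ> r) \<longlonglongrightarrow> x" "A x - z *\<^sub>C x = 0"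
    using approx_kernel_convergent_subseq[OF C m c, of X] X(1,2) by blast
  have "(\<lambda>j. norm ((X \<circ> r) j)) \<longlonglongrightarrow> norm x"
    by (rule tendsto_norm[OF x(2)])
  then have "norm x = 1"
    using X(2) LIMSEQ_unique[OF _ tendsto_const[of 1]] by simp
  then show ?thesis
    using x by (force simp: eigenspace_on_def)
qed

text \<open>Kernel vectors of the normal operator \<open>C = A - z\<close> are also annihilated by its adjoint, and so are orthogonal to the range of \<open>C\<close>.  If \<open>w\<close> in the spectrum approached \<open>z\<close>, then
  approximate eigenvectors for \<open>w\<close>, being almost of the form \<open>C x / (w - z)\<close>, would be almost
  orthogonal to the eigenvectors for \<open>z\<close>; yet they accumulate at one of them.\<close>

lemma bounded_below_on_tail_imp_not_islimpt:
  assumes A: "normal_op_on (tail_space n) A" and m: "n \<le> m"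
    and c: "c > 0" "\<forall>x\<in>tail_space m. c * norm x \<le> norm (A x - z *\<^sub>C x)"
  shows "\<not> z islimpt spectrum_on (tail_space n) A"
proof
  assume lim: "z islimpt spectrum_on (tail_space n) A"
  note S = subspace_tail_space[of n] closed_tail_space[of n]
  define C where "C x = A x - z *\<^sub>C x" for x
  have C: "normal_op_on (tail_space n) C"
    using normal_op_on_shift[OF A S(1), of z] by (simp add: C_def[abs_def])
  obtain B where B: "bounded_op_on (tail_space n) C" "bounded_op_on (tail_space n) B"
    "\<And>x y. x \<in> tail_space n \<Longrightarrow> y \<in> tail_space n \<Longrightarrow> cinner (C x) y = cinner x (B y)"
    "\<And>x. x \<in> tail_space n \<Longrightarrow> C (B x) = B (C x)"
    using normal_op_onE[OF C] by blast
  have pos: "inverse (real (Suc j)) > 0" for j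
    by simp
  have "\<exists>w x. w \<noteq> z \<and> cmod (w - z) < inverse (real (Suc j)) \<and> x \<in> tail_space n \<and> norm x = 1 \<and>
      norm (A x - w *\<^sub>C x) < cmod (w - z) * inverse (real (Suc j))" for j
  proof -
    obtain w where w: "w \<in> spectrum_on (tail_space n) A" "w \<noteq> z"
      "dist w z < inverse (real (Suc j))"
      using lim pos unfolding islimpt_approachable by blast
    then have "cmod (w - z) * inverse (real (Suc j)) > 0"
      by simp
    from spectrum_unit_approx_eigenvector[OF A S w(1) this] show ?thesis
      using w by (auto simp: dist_norm)
  qed
  then obtain W X where WX: "\<And>j. W j \<noteq> z" "\<And>j. cmod (W j - z) < inverse (real (Suc j))"
    "\<And>j. X j \<in> tail_space n" "\<And>j. norm (X j) = 1"
    "\<And>j. norm (A (X j) - W j *\<^sub>C X j) < cmod (W j - z) * inverse (real (Suc j))"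
    by metis
  have C_eq: "C (X j) = (A (X j) - W j *\<^sub>C X j) + (W j - z) *\<^sub>C X j" for j
    by (simp add: C_def ell2.scale_left_diff_distrib)
  have "norm (C (X j)) \<le> 2 * inverse (real (Suc j))" for j
  proof -
    have "inverse (real (Suc j)) \<le> 1"
      by (simp add: field_simps)
    then have "cmod (W j - z) * inverse (real (Suc j)) \<le> 1 * inverse (real (Suc j))"
      using WX(2)[of j] by (intro mult_right_mono) (linarith, simp)
    moreover have "norm (C (X j)) \<le> norm (A (X j) - W j *\<^sub>C X j) + cmod (W j - z)"
      using norm_triangle_ineq[of "A (X j) - W j *\<^sub>C X j" "(W j - z) *\<^sub>C X j"] WX(4)[of j]
      unfolding C_eq by simp
    ultimately show ?thesis
      using WX(2,5)[of j] by linarith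
  qed
  then have "(\<lambda>j. C (X j)) \<longlonglongrightarrow> 0"
    by (intro Lim_null_comparison[OF _ tendsto_mult_right_zero[OF LIMSEQ_inverse_real_of_nat]]
        eventuallyI)
  moreover have c_C: "\<forall>x\<in>tail_space m. c * norm x \<le> norm (C x)"
    using c(2) by (simp add: C_def)
  ultimately obtain r x where r: "strict_mono (r :: nat \<Rightarrow> nat)"
    and x: "x \<in> tail_space n" "(X \<circ> r) \<longlonglongrightarrow> x" "C x = 0"
    using approx_kernel_convergent_subseq[OF B(1) m c(1) c_C, of X] WX(3,4) by blast
  have "(\<lambda>j. norm ((X \<circ> r) j)) \<longlonglongrightarrow> norm x"
    by (rule tendsto_norm[OF x(2)])
  then have x1: "norm x = 1"
    using WX(4) LIMSEQ_unique[OF _ tendsto_const[of 1]] by simp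
  have "B x = 0"
    using norm_adjoint_eq[OF B x(1)] x(3) by simp
  have "cmod (cinner (X j) x) \<le> inverse (real (Suc j))" for j
  proof -
    have "cinner (C (X j)) x = 0"
      using B(3)[OF WX(3) x(1)] \<open>B x = 0\<close> by simp
    then have "(W j - z) * cinner (X j) x = - cinner (A (X j) - W j *\<^sub>C X j) x"
      unfolding C_eq cinner_add_left cinner_scaleC_left by (simp add: eq_neg_iff_add_eq_0 add.commute)
    then have "cmod (W j - z) * cmod (cinner (X j) x) = cmod (cinner (A (X j) - W j *\<^sub>C X j) x)"
      by (metis norm_minus_cancel norm_mult)
    also have "\<dots> \<le> norm (A (X j) - W j *\<^sub>C X j) * norm x"
      by (rule cinner_le_norm)
    also have "\<dots> \<le> cmod (W j - z) * inverse (real (Suc j))"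
      using WX(5)[of j] x1 by simp
    finally show ?thesis
      using WX(1)[of j] by simp
  qed
  then have "(\<lambda>j. cinner (X j) x) \<longlonglongrightarrow> 0"
    by (intro Lim_null_comparison[OF _ LIMSEQ_inverse_real_of_nat] eventuallyI)
  then have "(\<lambda>j. cinner ((X \<circ> r) j) x) \<longlonglongrightarrow> 0"
    using LIMSEQ_subseq_LIMSEQ[OF _ r] by (fastforce simp: o_def)
  then have "cinner x x = 0"
    using LIMSEQ_unique tendsto_cinner_left[OF x(2)] by blast
  then show False
    using x1 by (simp add: cinner_self)
qed

text \<open>Let \<open>0\<close> be isolated in the spectrum of the normal operator \<open>C\<close>.  For small \<open>w\<close> the nearest point
  of the spectrum to \<open>w\<close> is at distance at least \<open>cmod w\<close>, so that
  \<open>cmod w * norm x \<le> norm (C x - w x)\<close>.  After squaring, \<open>(cmod w * norm x)\<^sup>2\<close> cancels, and the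
  mixed term is left to be bounded by \<open>norm (C x)\<^sup>2\<close>.\<close>

lemma quadratic_form_le_if_isolated:
  assumes S: "ell2.subspace S" "closed S" and C: "normal_op_on S C" and s: "s > 0"
    and iso: "\<forall>w\<in>spectrum_on S C. cmod w < 2 * s \<longrightarrow> w = 0" and x: "x \<in> S"
  shows "2 * s * cmod (cinner (C x) x) \<le> (norm (C x))\<^sup>2"
proof (cases "cinner (C x) x = 0")
  case False
  define q where "q = cinner (C x) x"
  \<comment> \<open>The phase of \<open>w\<close> makes the mixed term \<open>cnj w * q\<close> real and positive.\<close>
  define w where "w = (s / cmod q) *\<^sub>R q"
  have w: "cmod w = s"
    using False s by (simp add: w_def q_def)
  have "cnj w * q = of_real (s / cmod q) * (q * cnj q)"
    by (simp add: w_def scaleR_conv_of_real)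
  also have "\<dots> = of_real (s / cmod q * (cmod q)\<^sup>2)"
    by (simp only: complex_norm_square[symmetric] of_real_mult)
  also have "s / cmod q * (cmod q)\<^sup>2 = s * cmod q"
    by (simp add: power2_eq_square)
  finally have wq: "cnj w * q = of_real (s * cmod q)" .
  have "s * norm x \<le> norm (C x - w *\<^sub>C x)"
  proof (rule ccontr)
    assume "\<not> ?thesis"
    then have less: "norm (C x - w *\<^sub>C x) < s * norm x"
      by simp
    have x0: "x \<noteq> 0"
      using False by auto
    define e where "e = norm (C x - w *\<^sub>C x) / norm x"
    have e: "norm (C x - w *\<^sub>C x) \<le> e * norm x" "e < s"
      using less x0 by (simp_all add: e_def field_simps)
    obtain v where v: "v \<in> spectrum_on S C" "cmod (v - w) \<le> e"
      using spectrum_near_approx_eigenvalue[OF S C x x0 e(1)] by blast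
    have "cmod v \<le> cmod (v - w) + cmod w"
      using norm_triangle_ineq[of "v - w" w] by simp
    then have "v = 0"
      using bspec[OF iso v(1)] v(2) w e(2) by linarith
    then show False
      using v(2) w e(2) by simp
  qed
  then have "(s * norm x)\<^sup>2 \<le> (norm (C x - w *\<^sub>C x))\<^sup>2"
    using s by (intro power_mono) auto
  also have "\<dots> = (norm (C x))\<^sup>2 - 2 * Re (cnj w * q) + (s * norm x)\<^sup>2"
    unfolding norm_diff_sq cinner_scaleC_right q_def by (simp add: w)
  finally have "2 * Re (cnj w * q) \<le> (norm (C x))\<^sup>2"
    by simp
  then show ?thesis
    unfolding wq by (simp add: q_def)
qed simp

text \<open>Polarisation extends the bound of the quadratic form to \<open>cinner (C x) y\<close>, and \<open>y = (1 / s) C x\<close>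
  makes it a lower bound for \<open>C\<close> on its own range.\<close>

lemma bounded_below_on_range_if_isolated:
  assumes S: "ell2.subspace S" "closed S" and C: "normal_op_on S C" and s: "s > 0"
    and iso: "\<forall>w\<in>spectrum_on S C. cmod w < 2 * s \<longrightarrow> w = 0" and x: "x \<in> S"
  shows "s * norm (C x) \<le> norm (C (C x))"
proof -
  have bC: "bounded_op_on S C"
    using C by (simp add: normal_op_on_def)
  note form = quadratic_form_le_if_isolated[OF S C s iso]
  have polar: "2 * s * cmod (cinner (C u) v) \<le> (norm (C u))\<^sup>2 + (norm (C v))\<^sup>2"
    if u: "u \<in> S" and v: "v \<in> S" for u v
  proof -
    let ?q = "\<lambda>a. cinner (C (u + a *\<^sub>C v)) (u + a *\<^sub>C v)"
    have in_S: "u + a *\<^sub>C v \<in> S" "a *\<^sub>C v \<in> S" for a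
      using u v S(1) by (auto simp: ell2.subspace_add ell2.subspace_scale)
    have C_eq: "C (u + a *\<^sub>C v) = C u + a *\<^sub>C C v" for a
      by (simp add: bounded_op_on_add[OF bC u in_S(2)] bounded_op_on_scaleC[OF bC v])
    have "4 * cinner (C u) v = ?q 1 - ?q (- 1) + \<i> * ?q \<i> - \<i> * ?q (- \<i>)"
      unfolding C_eq cinner_simps by (simp add: algebra_simps)
    then have "4 * cmod (cinner (C u) v) = cmod (?q 1 - ?q (- 1) + \<i> * ?q \<i> - \<i> * ?q (- \<i>))"
      by (metis norm_mult norm_numeral)
    also have "\<dots> \<le> cmod (?q 1) + cmod (?q (- 1)) + cmod (\<i> * ?q \<i>) + cmod (\<i> * ?q (- \<i>))"
      by (intro order_trans[OF norm_triangle_ineq4] order_trans[OF norm_triangle_ineq] add_mono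
          order_refl)
    finally have "2 * s * (4 * cmod (cinner (C u) v))
        \<le> 2 * s * (cmod (?q 1) + cmod (?q (- 1)) + cmod (?q \<i>) + cmod (?q (- \<i>)))"
      using s by (intro mult_left_mono) (auto simp: norm_mult)
    also have "\<dots> \<le> (norm (C u + 1 *\<^sub>C C v))\<^sup>2 + (norm (C u + (- 1) *\<^sub>C C v))\<^sup>2
        + (norm (C u + \<i> *\<^sub>C C v))\<^sup>2 + (norm (C u + (- \<i>) *\<^sub>C C v))\<^sup>2"
      using form[OF in_S(1)[of 1]] form[OF in_S(1)[of "- 1"]] form[OF in_S(1)[of \<i>]]
        form[OF in_S(1)[of "- \<i>"]]
      unfolding C_eq distrib_left by linarith
    also have "\<dots> = 4 * ((norm (C u))\<^sup>2 + (norm (C v))\<^sup>2)"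
      unfolding norm_add_sq cinner_scaleC_right by simp
    finally show ?thesis
      by simp
  qed
  define y where "y = C x"
  have y: "y \<in> S"
    using bounded_op_on_in[OF bC x] by (simp add: y_def)
  define a where "a = complex_of_real (1 / s)"
  have "2 * s * cmod (cinner y (a *\<^sub>C y)) \<le> (norm y)\<^sup>2 + (norm (C (a *\<^sub>C y)))\<^sup>2"
    using polar[OF x, of "a *\<^sub>C y"] y S(1) by (simp add: y_def ell2.subspace_scale)
  moreover have "2 * s * cmod (cinner y (a *\<^sub>C y)) = 2 * (norm y)\<^sup>2"
    using s by (simp add: a_def cinner_scaleC_right cinner_self norm_mult norm_divide norm_power)
  moreover have "norm (C (a *\<^sub>C y)) = norm (C y) / s"
    using s by (simp add: bounded_op_on_scaleC[OF bC y] a_def norm_divide)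
  ultimately have "(norm y)\<^sup>2 \<le> (norm (C y) / s)\<^sup>2"
    by simp
  then have "norm y \<le> norm (C y) / s"
    using s by (intro power2_le_imp_le[of "norm y"]) auto
  then show ?thesis
    using s by (simp add: y_def field_simps)
qed

text \<open>On the closure of its range, \<open>C\<close> is again normal, and it is bounded below there; so it is
  surjective there, and \<open>C x = C y\<close> for some \<open>y\<close> in that closure.  The kernel vector is \<open>x - y\<close>.\<close>

lemma near_kernel_if_isolated:
  assumes S: "ell2.subspace S" "closed S" and C: "normal_op_on S C" and s: "s > 0"
    and iso: "\<forall>w\<in>spectrum_on S C. cmod w < 2 * s \<longrightarrow> w = 0" and x: "x \<in> S"
  shows "\<exists>k\<in>S. C k = 0 \<and> s * norm (x - k) \<le> norm (C x)"
proof -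
  obtain B where B: "bounded_op_on S C" "bounded_op_on S B"
    "\<And>x y. x \<in> S \<Longrightarrow> y \<in> S \<Longrightarrow> cinner (C x) y = cinner x (B y)"
    "\<And>x. x \<in> S \<Longrightarrow> C (B x) = B (C x)"
    using normal_op_onE[OF C] by blast
  define R where "R = closure (C ` S)"
  have R_S: "R \<subseteq> S"
    unfolding R_def using S(2) bounded_op_on_in[OF B(1)] by (intro closure_minimal) auto
  have R_seq: "\<exists>X. (\<forall>j. X j \<in> S) \<and> (\<lambda>j. C (X j)) \<longlonglongrightarrow> y" if "y \<in> R" for y
  proof -
    obtain f where f: "\<forall>j. f j \<in> C ` S" "f \<longlonglongrightarrow> y"
      using \<open>y \<in> R\<close> unfolding R_def closure_sequential by blast
    then have "\<forall>j. \<exists>u\<in>S. f j = C u"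
      by auto
    then obtain X where X: "\<And>j. X j \<in> S" "\<And>j. f j = C (X j)"
      by metis
    then have "f = (\<lambda>j. C (X j))"
      by auto
    then show ?thesis
      using f(2) X(1) by blast
  qed
  have R_lim: "y \<in> R" if "\<And>j. X j \<in> S" "(\<lambda>j. C (X j)) \<longlonglongrightarrow> y" for X y
    unfolding R_def closure_sequential using that by (intro exI[of _ "\<lambda>j. C (X j)"]) auto
  have subR: "ell2.subspace R"
    unfolding ell2.subspace_def
  proof (intro conjI ballI allI)
    have "C 0 = 0"
      using bounded_op_on_diff[OF B(1) S(1) x x] by simp
    then show "0 \<in> R"
      using R_lim[of "\<lambda>_. 0" 0] ell2.subspace_0[OF S(1)] by simp
  next
    fix u v
    assume "u \<in> R" "v \<in> R"
    then obtain X Y where X: "\<And>j. X j \<in> S" "(\<lambda>j. C (X j)) \<longlonglongrightarrow> u"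
      and Y: "\<And>j. Y j \<in> S" "(\<lambda>j. C (Y j)) \<longlonglongrightarrow> v"
      using R_seq by metis
    have "(\<lambda>j. C (X j + Y j)) \<longlonglongrightarrow> u + v"
      using tendsto_add[OF X(2) Y(2)] by (simp add: bounded_op_on_add[OF B(1) X(1) Y(1)])
    then show "u + v \<in> R"
      using R_lim[of "\<lambda>j. X j + Y j"] X(1) Y(1) ell2.subspace_add[OF S(1)] by simp
  next
    fix a u
    assume "u \<in> R"
    then obtain X where X: "\<And>j. X j \<in> S" "(\<lambda>j. C (X j)) \<longlonglongrightarrow> u"
      using R_seq by metis
    have "(\<lambda>j. C (a *\<^sub>C X j)) \<longlonglongrightarrow> a *\<^sub>C u"
      using tendsto_scaleC[OF X(2)] by (simp add: bounded_op_on_scaleC[OF B(1) X(1)])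
    then show "a *\<^sub>C u \<in> R"
      using R_lim[of "\<lambda>j. a *\<^sub>C X j"] X(1) ell2.subspace_scale[OF S(1)] by simp
  qed
  have C_R: "C y \<in> R" if "y \<in> R" for y
    using that R_S by (auto simp: R_def intro: subsetD[OF closure_subset])
  have B_R: "B y \<in> R" if y: "y \<in> R" for y
  proof -
    obtain X where X: "\<And>j. X j \<in> S" "(\<lambda>j. C (X j)) \<longlonglongrightarrow> y"
      using R_seq[OF y] by blast
    have "(\<lambda>j. B (C (X j))) \<longlonglongrightarrow> B y"
      using X(1) y R_S bounded_op_on_in[OF B(1)]
      by (intro bounded_op_on_tendsto[OF B(2) S(1) _ _ X(2)]) auto
    then have "(\<lambda>j. C (B (X j))) \<longlonglongrightarrow> B y"
      by (simp add: B(4)[OF X(1)])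
    then show ?thesis
      using R_lim[of "\<lambda>j. B (X j)"] X(1) bounded_op_on_in[OF B(2)] by simp
  qed
  have restrict: "bounded_op_on R D" if "bounded_op_on S D" "\<And>y. y \<in> R \<Longrightarrow> D y \<in> R" for D
    using that R_S unfolding bounded_op_on_def by (meson subsetD)
  have "adjoint_on R C B"
    unfolding adjoint_on_def using restrict[OF B(2) B_R] B(3) R_S by blast
  then have normal: "normal_op_on R C"
    unfolding normal_op_on_def using restrict[OF B(1) C_R] B(4) R_S by blast
  have lower: "s * norm y \<le> norm (C y)" if y: "y \<in> R" for y
  proof -
    obtain X where X: "\<And>j. X j \<in> S" "(\<lambda>j. C (X j)) \<longlonglongrightarrow> y"
      using R_seq[OF y] by blast
    have "(\<lambda>j. C (C (X j))) \<longlonglongrightarrow> C y"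
      using X(1) y R_S bounded_op_on_in[OF B(1)]
      by (intro bounded_op_on_tendsto[OF B(1) S(1) _ _ X(2)]) auto
    then show ?thesis
      using bounded_below_on_range_if_isolated[OF S C s iso X(1)]
      by (intro LIMSEQ_le[OF tendsto_mult[OF tendsto_const tendsto_norm[OF X(2)]] tendsto_norm])
        auto
  qed
  have "closed R"
    by (simp add: R_def)
  moreover have "C x \<in> R"
    using x by (auto simp: R_def intro: subsetD[OF closure_subset])
  ultimately obtain y where y: "y \<in> R" "C y = C x"
    using normal_bounded_below_surj[OF normal subR _ s lower] by blast
  have yS: "y \<in> S"
    using y(1) R_S by blast
  have "C (x - y) = 0"
    using bounded_op_on_diff[OF B(1) S(1) x yS] y(2) by simp
  moreover have "s * norm (x - (x - y)) \<le> norm (C x)"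
    using lower[OF y(1)] y(2) by simp
  ultimately show ?thesis
    using x yS S(1) by (intro bexI[of _ "x - y"]) (auto simp: ell2.subspace_diff)
qed

text \<open>A vector \<open>x\<close> far out is almost orthogonal to the finite-dimensional kernel of \<open>C = A - z\<close>, hence
  not close to it; as \<open>norm (C x)\<close> controls the distance from \<open>x\<close> to a kernel vector, it also
  controls \<open>norm x\<close>.\<close>

lemma bounded_below_on_tail_if_isolated:
  assumes A: "normal_op_on (tail_space n) A" and iso: "z isolated_in spectrum_on (tail_space n) A"
    and F: "finite F" "eigenspace_on (tail_space n) A z = ell2.span F"
  shows "\<exists>m\<ge>n. \<exists>c>0. \<forall>x\<in>tail_space m. c * norm x \<le> norm (A x - z *\<^sub>C x)"
proof -
  note S = subspace_tail_space[of n] closed_tail_space[of n]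
  define C where "C x = A x - z *\<^sub>C x" for x
  have C: "normal_op_on (tail_space n) C"
    using normal_op_on_shift[OF A S(1), of z] by (simp add: C_def[abs_def])
  obtain e where e: "e > 0" "\<And>w. w \<in> spectrum_on (tail_space n) A \<Longrightarrow> dist w z < e \<Longrightarrow> w = z"
    using iso unfolding isolated_in_dist_Ex_iff by (metis dist_commute)
  define s where "s = e / 2"
  have s: "s > 0"
    using e(1) by (simp add: s_def)
  have iso_C: "\<forall>w\<in>spectrum_on (tail_space n) C. cmod w < 2 * s \<longrightarrow> w = 0"
  proof (intro ballI impI)
    fix w
    assume w: "w \<in> spectrum_on (tail_space n) C" "cmod w < 2 * s"
    have "z + w \<in> spectrum_on (tail_space n) A"
      using w(1) spectrum_on_shift[of w "tail_space n" A z] by (simp add: C_def[abs_def])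
    then show "w = 0"
      using e(2)[of "z + w"] w(2) by (simp add: dist_norm s_def)
  qed
  obtain m where m: "\<And>x u. x \<in> tail_space m \<Longrightarrow> u \<in> ell2.span F \<Longrightarrow>
      cmod (cinner x u) \<le> 1 / 2 * norm x * norm u"
    using tail_almost_orthogonal_finite_span[OF F(1), of "1 / 2"] by auto
  have "s / 3 * norm x \<le> norm (A x - z *\<^sub>C x)" if x: "x \<in> tail_space (max n m)" for x
  proof -
    have x1: "x \<in> tail_space n" and x2: "x \<in> tail_space m"
      using x by (auto simp: tail_space_def)
    obtain k where k: "k \<in> tail_space n" "C k = 0" "s * norm (x - k) \<le> norm (C x)"
      using near_kernel_if_isolated[OF S C s iso_C x1] by blast
    have "k \<in> ell2.span F"
      using k F(2) by (auto simp: eigenspace_on_def C_def)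
    then have 1: "cmod (cinner x k) \<le> 1 / 2 * norm x * norm k"
      by (rule m[OF x2])
    have 2: "norm k \<le> norm x + norm (x - k)"
      using norm_triangle_ineq4[of x "x - k"] by simp
    have "norm x * norm x = cmod (cinner x x)"
      by (simp add: cinner_self norm_power power2_eq_square norm_mult)
    also have "\<dots> = cmod (cinner x (x - k) + cinner x k)"
      by (simp add: cinner_diff_right)
    also have "\<dots> \<le> norm x * norm (x - k) + 1 / 2 * norm x * norm k"
      using norm_triangle_ineq[of "cinner x (x - k)" "cinner x k"] cinner_le_norm[of x "x - k"] 1
      by linarith
    also have "\<dots> \<le> norm x * norm (x - k) + 1 / 2 * norm x * (norm x + norm (x - k))"
      using 2 by (intro add_mono mult_left_mono) auto
    finally have "norm x * norm x \<le> norm x * (3 * norm (x - k))"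
      by (simp add: algebra_simps)
    then have "norm x \<le> 3 * norm (x - k)"
      by (cases "norm x = 0") auto
    then have "s * norm x \<le> s * (3 * norm (x - k))"
      using s by (intro mult_left_mono) auto
    then show ?thesis
      using k(3) by (simp add: C_def)
  qed
  then show ?thesis
    using s by (intro exI[of _ "max n m"] conjI exI[of _ "s / 3"]) auto
qed

text \<open>Weyl's criterion: a singular sequence for \<open>z\<close> is a sequence of unit vectors that move out along
  the coordinates while their images under \<open>A - z\<close> tend to \<open>0\<close>, and the right-hand side says that there
  is none.\<close>

theorem not_in_ess_spectrum_iff_bounded_below_on_tail:
  assumes A: "normal_op_on (tail_space n) A"
  shows "z \<notin> ess_spectrum_on (tail_space n) A \<longleftrightarrow>
    (\<exists>m\<ge>n. \<exists>c>0. \<forall>x\<in>tail_space m. c * norm x \<le> norm (A x - z *\<^sub>C x))"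
proof
  assume z: "z \<notin> ess_spectrum_on (tail_space n) A"
  show "\<exists>m\<ge>n. \<exists>c>0. \<forall>x\<in>tail_space m. c * norm x \<le> norm (A x - z *\<^sub>C x)"
  proof (cases "z \<in> spectrum_on (tail_space n) A")
    case True
    then show ?thesis
      using z bounded_below_on_tail_if_isolated[OF A] by (auto simp: ess_spectrum_on_def)
  next
    case False
    then show ?thesis
      using not_in_spectrum_iff_bounded_below[OF A subspace_tail_space closed_tail_space] by blast
  qed
next
  assume "\<exists>m\<ge>n. \<exists>c>0. \<forall>x\<in>tail_space m. c * norm x \<le> norm (A x - z *\<^sub>C x)"
  then obtain m c where m: "n \<le> m" and c: "c > 0"
    "\<forall>x\<in>tail_space m. c * norm x \<le> norm (A x - z *\<^sub>C x)"
    by blast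
  have bA: "bounded_op_on (tail_space n) A"
    using A by (simp add: normal_op_on_def)
  show "z \<notin> ess_spectrum_on (tail_space n) A"
    using bounded_below_on_tail_imp_not_islimpt[OF A m c]
      bounded_below_on_tail_imp_eigenvalue[OF A m c]
      bounded_below_on_tail_imp_finite_eigenspace[OF bA c]
    by (auto simp: ess_spectrum_on_def isolated_in_islimpt_iff)
qed

section \<open>Band operators and their truncations\<close>

text \<open>The existence of an adjoint gives the expansion of \<open>T x\<close> in the matrix entries of \<open>T\<close>
  coordinate by coordinate.\<close>

lemma coord_bounded_op:
  assumes "bounded_op_on UNIV B" "\<And>x y. cinner (T x) y = cinner x (B y)"
  shows "coord (T x) i = (\<Sum>k. coord x k * cinner (T (ell2_basis k)) (ell2_basis i))"
proof -
  have "coord (T x) i = cinner x (B (ell2_basis i))"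
    unfolding coord_eq_cinner assms(2) ..
  moreover have "cnj (coord (B (ell2_basis i)) k) = cinner (T (ell2_basis k)) (ell2_basis i)" for k
    unfolding coord_eq_cinner assms(2) by (metis cinner_commute)
  ultimately show ?thesis
    by (simp add: cinner_def[of x])
qed

lemma band_op_shifts_support:
  assumes "normal_op_on UNIV T" "band_op T"
  obtains N where "\<And>n x. x \<in> tail_space (n + N) \<Longrightarrow> T x \<in> tail_space n"
    and "\<And>n x. x \<in> ell2_n n \<Longrightarrow> T x \<in> ell2_n (n + N)"
proof -
  obtain B where B: "bounded_op_on UNIV B" "\<And>x y. cinner (T x) y = cinner x (B y)"
    using normal_op_onE[OF assms(1)] by (metis UNIV_I)
  obtain N where N: "\<And>i j. \<bar>int i - int j\<bar> > int N \<Longrightarrow> cinner (T (ell2_basis j)) (ell2_basis i) = 0"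
    using assms(2) unfolding band_op_def by blast
  have zero: "coord (T x) i = 0" if "\<And>k. coord x k = 0 \<or> \<bar>int i - int k\<bar> > int N" for x i
  proof -
    have "coord x k * cinner (T (ell2_basis k)) (ell2_basis i) = 0" for k
      using that[of k] N by auto
    then show ?thesis
      by (simp only: coord_bounded_op[OF B] suminf_zero)
  qed
  show ?thesis
  proof (rule that)
    fix n x
    assume x: "x \<in> tail_space (n + N)"
    have "coord (T x) i = 0" if "i < n" for i
    proof (rule zero)
      show "coord x k = 0 \<or> \<bar>int i - int k\<bar> > int N" for k
        using x that by (cases "k < n + N") (auto simp: tail_space_def)
    qed
    then show "T x \<in> tail_space n"
      by (simp add: tail_space_def)
  next
    fix n x
    assume x: "x \<in> ell2_n n"
    have "coord (T x) i = 0" if "i \<ge> n + N" for i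
    proof (rule zero)
      show "coord x k = 0 \<or> \<bar>int i - int k\<bar> > int N" for k
        using x that by (cases "k < n") (auto simp: ell2_n_eq)
    qed
    then show "T x \<in> ell2_n (n + N)"
      by (simp add: ell2_n_eq)
  qed
qed

lemma truncation_on_eq:
  assumes "truncation_on S T A" "x \<in> S" "T x \<in> S"
  shows "A x = T x"
proof -
  obtain Q S' where Q: "projection_along Q S S'" "\<And>x. x \<in> S \<Longrightarrow> A x = Q (T x)"
    using assms(1) unfolding truncation_on_def by blast
  have "T x - Q (T x) \<in> S" "T x - Q (T x) \<in> S'"
    using Q(1) assms(3) by (simp_all add: projection_along_def ell2.subspace_diff)
  moreover have "S \<inter> S' = {0}"
    using Q(1) by (simp add: projection_along_def)
  ultimately have "T x - Q (T x) = 0"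
    by blast
  then show ?thesis
    using Q(2)[OF assms(2)] by simp
qed

lemma norm_le_onorm_on:
  assumes A: "bounded_op_on S A" and x: "x \<in> S"
  shows "norm (A x) \<le> onorm_on S A * norm x"
proof -
  obtain K where K: "K > 0" "\<And>x. x \<in> S \<Longrightarrow> norm (A x) \<le> K * norm x"
    using bounded_op_on_bound[OF A] by blast
  show ?thesis
  proof (cases "x = 0")
    case True
    then show ?thesis
      using K(2)[OF x] by simp
  next
    case False
    have "norm (A y) / norm y \<le> K" if "y \<in> S" for y
      using K(1) K(2)[OF that] by (cases "y = 0") (auto simp: field_simps)
    then have "bdd_above ((\<lambda>y. norm (A y) / norm y) ` S)"
      by (intro bdd_aboveI[of _ K]) auto
    then have "norm (A x) / norm x \<le> onorm_on S A"
      unfolding onorm_on_def using x by (intro cSUP_upper)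
    then show ?thesis
      using False by (simp add: field_simps)
  qed
qed

text \<open>The sequences \<open>Tn n (head p x)\<close> are eventually equal to \<open>T (head p x)\<close> for fixed \<open>p\<close>, and the
  uniform bound on the \<open>Tn n\<close> absorbs the difference between \<open>head p x\<close> and \<open>head n x\<close>.\<close>

lemma truncations_tendsto:
  assumes T: "bounded_op_on UNIV T"
    and L: "\<And>n x. n \<ge> 1 \<Longrightarrow> x \<in> ell2_n n \<Longrightarrow> norm (Tn n x) \<le> L * norm x"
    and Tn: "\<And>n. n \<ge> 1 \<Longrightarrow> bounded_op_on (ell2_n n) (Tn n)"
    and eq: "\<And>p n x. n \<ge> 1 \<Longrightarrow> p + N \<le> n \<Longrightarrow> x \<in> ell2_n p \<Longrightarrow> Tn n x = T x"
  shows "(\<lambda>n. Tn n (head n x)) \<longlonglongrightarrow> T x"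
proof (rule metric_LIMSEQ_I)
  fix e :: real
  assume e: "e > 0"
  define K where "K = \<bar>L\<bar> + 1"
  have K: "K > 0" "L \<le> K"
    by (auto simp: K_def)
  have T_lim: "(\<lambda>p. T (head p x)) \<longlonglongrightarrow> T x"
    by (rule bounded_op_on_tendsto[OF T _ _ _ head_tendsto]) auto
  have "\<forall>\<^sub>F p in sequentially. dist (T (head p x)) (T x) < e / 2"
    using e by (intro tendstoD[OF T_lim]) simp
  moreover have near: "\<forall>\<^sub>F p in sequentially. dist (head p x) x < e / (4 * K)"
    using e K by (intro tendstoD[OF head_tendsto]) simp
  ultimately have "\<forall>\<^sub>F p in sequentially. dist (T (head p x)) (T x) < e / 2 \<and>
      dist (head p x) x < e / (4 * K)"
    by (rule eventually_conj)
  then obtain p where p: "dist (T (head p x)) (T x) < e / 2" "dist (head p x) x < e / (4 * K)"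
    unfolding eventually_sequentially by blast
  obtain M where M: "\<And>n. n \<ge> M \<Longrightarrow> dist (head n x) x < e / (4 * K)"
    using near unfolding eventually_sequentially by blast
  have "dist (Tn n (head n x)) (T x) < e" if n: "n \<ge> max (max 1 M) (p + N)" for n
  proof -
    have n1: "n \<ge> 1"
      using n by simp
    have in_n: "head n x \<in> ell2_n n" "head p x \<in> ell2_n n"
      using head_in_ell2_n ell2_n_mono[of p n] n by auto
    have "Tn n (head n x) - T (head p x) = Tn n (head n x - head p x)"
      using eq[of n p "head p x"] n head_in_ell2_n
        bounded_op_on_diff[OF Tn[OF n1] subspace_ell2_n in_n] by simp
    then have "dist (Tn n (head n x)) (T (head p x)) \<le> L * norm (head n x - head p x)"
      using L[OF n1, of "head n x - head p x"] in_n subspace_ell2_n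
      by (simp add: dist_norm ell2.subspace_diff)
    also have "\<dots> \<le> K * norm (head n x - head p x)"
      using K by (intro mult_right_mono) auto
    also have "norm (head n x - head p x) \<le> dist (head n x) x + dist (head p x) x"
      unfolding dist_norm[symmetric] by (rule dist_triangle2)
    also have "\<dots> \<le> e / (4 * K) + e / (4 * K)"
      using M[of n] n p(2) by (intro add_mono) auto
    finally have "dist (Tn n (head n x)) (T (head p x)) \<le> e / 2"
      using K(1) by simp
    then show ?thesis
      using p(1) dist_triangle[of "Tn n (head n x)" "T x" "T (head p x)"] by linarith
  qed
  then show "\<exists>M. \<forall>n\<ge>M. dist (Tn n (head n x)) (T x) < e"
    by blast
qed

text \<open>A unit approximate eigenvector \<open>x\<close> of \<open>T\<close> is replaced by a finite section \<open>head p x\<close>, on which \<open>T\<close>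
  and the truncations eventually agree.\<close>

lemma truncations_infdist_tendsto_0:
  assumes T: "normal_op_on UNIV T" and z: "z \<in> spectrum_on UNIV T"
    and Tn: "\<And>n. n \<ge> 1 \<Longrightarrow> normal_op_on (ell2_n n) (Tn n)"
    and eq: "\<And>p n x. n \<ge> 1 \<Longrightarrow> p + N \<le> n \<Longrightarrow> x \<in> ell2_n p \<Longrightarrow> Tn n x = T x"
  shows "(\<lambda>n. infdist z (spectrum_on (ell2_n n) (Tn n))) \<longlonglongrightarrow> 0"
proof (rule metric_LIMSEQ_I)
  fix e :: real
  assume e: "e > 0"
  have "normal_op_on UNIV (\<lambda>x. T x - z *\<^sub>C x)"
    by (rule normal_op_on_shift[OF T]) simp
  then have C: "bounded_op_on UNIV (\<lambda>x. T x - z *\<^sub>C x)"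
    by (simp add: normal_op_on_def)
  obtain x where x: "norm x = 1" "norm (T x - z *\<^sub>C x) < e / 2"
    using spectrum_unit_approx_eigenvector[OF T _ _ z, of "e / 2"] e by auto
  have C_lim: "(\<lambda>p. T (head p x) - z *\<^sub>C head p x) \<longlonglongrightarrow> T x - z *\<^sub>C x"
    by (rule bounded_op_on_tendsto[OF C _ _ _ head_tendsto]) auto
  have "(\<lambda>p. e / 2 * norm (head p x) - norm (T (head p x) - z *\<^sub>C head p x))
      \<longlonglongrightarrow> e / 2 * norm x - norm (T x - z *\<^sub>C x)"
    by (intro tendsto_intros C_lim head_tendsto)
  then have "\<forall>\<^sub>F p in sequentially.
      0 < e / 2 * norm (head p x) - norm (T (head p x) - z *\<^sub>C head p x)"
    by (rule order_tendstoD) (use x in simp)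
  then obtain p where p: "norm (T (head p x) - z *\<^sub>C head p x) < e / 2 * norm (head p x)"
    unfolding eventually_sequentially by auto
  define y where "y = head p x"
  have y: "y \<noteq> 0"
    using p norm_ge_zero[of "T y - z *\<^sub>C y"] unfolding y_def[symmetric] by auto
  have "dist (infdist z (spectrum_on (ell2_n n) (Tn n))) 0 < e" if n: "n \<ge> max 1 (p + N)" for n
  proof -
    have n1: "n \<ge> 1"
      using n by simp
    have yn: "y \<in> ell2_n n"
      using head_in_ell2_n ell2_n_mono[of p n] n by (auto simp: y_def)
    have "norm (Tn n y - z *\<^sub>C y) \<le> e / 2 * norm y"
      using eq[of n p y] n p head_in_ell2_n by (simp add: y_def)
    then obtain w where w: "w \<in> spectrum_on (ell2_n n) (Tn n)" "cmod (w - z) \<le> e / 2"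
      using spectrum_near_approx_eigenvalue[OF subspace_ell2_n closed_ell2_n Tn[OF n1] yn y]
      by blast
    have "infdist z (spectrum_on (ell2_n n) (Tn n)) \<le> dist z w"
      by (rule infdist_le[OF w(1)])
    also have "\<dots> < e"
      using w(2) e by (simp add: dist_norm norm_minus_commute)
    finally show ?thesis
      by (simp add: infdist_nonneg)
  qed
  then show "\<exists>M. \<forall>n\<ge>M. dist (infdist z (spectrum_on (ell2_n n) (Tn n))) 0 < e"
    by blast
qed

text \<open>By Weyl's criterion, the essential spectrum depends only on the values of the operator far out,
  where the truncation coincides with \<open>T\<close>.\<close>

lemma ess_spectrum_truncation:
  assumes T: "normal_op_on UNIV T" and A: "normal_op_on (tail_space n) A"
    and eq: "\<And>x. x \<in> tail_space (n + N) \<Longrightarrow> A x = T x"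
  shows "ess_spectrum_on (tail_space n) A = ess_spectrum_on UNIV T"
proof -
  have T': "normal_op_on (tail_space 0) T"
    using T by (simp add: tail_space_0)
  have tail_le: "tail_space (max m (n + N)) \<subseteq> tail_space m"
    and tail_le': "tail_space (max m (n + N)) \<subseteq> tail_space (n + N)" for m
    by (rule tail_space_antimono, simp)+
  have "z \<notin> ess_spectrum_on (tail_space n) A \<longleftrightarrow> z \<notin> ess_spectrum_on (tail_space 0) T" for z
    unfolding not_in_ess_spectrum_iff_bounded_below_on_tail[OF A]
      not_in_ess_spectrum_iff_bounded_below_on_tail[OF T']
  proof
    assume "\<exists>m\<ge>n. \<exists>c>0. \<forall>x\<in>tail_space m. c * norm x \<le> norm (A x - z *\<^sub>C x)"
    then obtain m c where "c > 0" "\<forall>x\<in>tail_space m. c * norm x \<le> norm (A x - z *\<^sub>C x)"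
      by blast
    then have "\<forall>x\<in>tail_space (max m (n + N)). c * norm x \<le> norm (T x - z *\<^sub>C x)"
      using eq tail_le[of m] tail_le'[of m] by (metis subsetD)
    then show "\<exists>m\<ge>0. \<exists>c>0. \<forall>x\<in>tail_space m. c * norm x \<le> norm (T x - z *\<^sub>C x)"
      using \<open>c > 0\<close> by blast
  next
    assume "\<exists>m\<ge>0. \<exists>c>0. \<forall>x\<in>tail_space m. c * norm x \<le> norm (T x - z *\<^sub>C x)"
    then obtain m c where "c > 0" "\<forall>x\<in>tail_space m. c * norm x \<le> norm (T x - z *\<^sub>C x)"
      by blast
    then have "\<forall>x\<in>tail_space (max m (n + N)). c * norm x \<le> norm (A x - z *\<^sub>C x)"
      using eq tail_le[of m] tail_le'[of m] by (metis subsetD)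
    then show "\<exists>m\<ge>n. \<exists>c>0. \<forall>x\<in>tail_space m. c * norm x \<le> norm (A x - z *\<^sub>C x)"
      using \<open>c > 0\<close> by (intro exI[of _ "max m (n + N)"]) auto
  qed
  then show ?thesis
    by (auto simp: tail_space_0)
qed

theorem proposition2p1:
  fixes T :: "ell2 \<Rightarrow> ell2"
  assumes "normal_op_on UNIV T" and "band_op T"
  shows "(\<forall>Tn :: nat \<Rightarrow> ell2 \<Rightarrow> ell2.
            (\<forall>n\<ge>1. normal_truncation_on (ell2_n n) T (Tn n)) \<and>
            bounded ((\<lambda>n. onorm_on (ell2_n n) (Tn n)) ` {1..}) \<longrightarrow>
              (\<forall>x. (\<lambda>n. extend_zero (ell2_n n) (Tn n) x) \<longlonglongrightarrow> T x) \<and>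
              spectrum_on UNIV T \<subseteq>
                {z. (\<lambda>n. infdist z (spectrum_on (ell2_n n) (Tn n))) \<longlonglongrightarrow> 0}) \<and>
         (\<forall>n\<ge>1. \<forall>A :: ell2 \<Rightarrow> ell2.
            normal_truncation_on (orth_compl (ell2_n n)) T A \<longrightarrow>
              ess_spectrum_on (orth_compl (ell2_n n)) A = ess_spectrum_on UNIV T)"
proof -
  obtain N where N: "\<And>n x. x \<in> tail_space (n + N) \<Longrightarrow> T x \<in> tail_space n"
    "\<And>n x. x \<in> ell2_n n \<Longrightarrow> T x \<in> ell2_n (n + N)"
    using band_op_shifts_support[OF assms] by blast
  have T: "bounded_op_on UNIV T"
    using assms(1) by (simp add: normal_op_on_def)
  have "(\<forall>x. (\<lambda>n. extend_zero (ell2_n n) (Tn n) x) \<longlonglongrightarrow> T x) \<and>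
      spectrum_on UNIV T \<subseteq> {z. (\<lambda>n. infdist z (spectrum_on (ell2_n n) (Tn n))) \<longlonglongrightarrow> 0}"
    if trunc: "\<forall>n\<ge>1. normal_truncation_on (ell2_n n) T (Tn n)"
      and bdd: "bounded ((\<lambda>n. onorm_on (ell2_n n) (Tn n)) ` {1..})"
    for Tn :: "nat \<Rightarrow> ell2 \<Rightarrow> ell2"
  proof -
    have normal: "normal_op_on (ell2_n n) (Tn n)" if "n \<ge> 1" for n
      using trunc that by (simp add: normal_truncation_on_def)
    then have op: "bounded_op_on (ell2_n n) (Tn n)" if "n \<ge> 1" for n
      using that by (simp add: normal_op_on_def)
    have eq: "Tn n x = T x" if "n \<ge> 1" "p + N \<le> n" "x \<in> ell2_n p" for p n x
    proof (rule truncation_on_eq[where A = "Tn n"])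
      show "truncation_on (ell2_n n) T (Tn n)"
        using trunc that(1) by (simp add: normal_truncation_on_def)
      show "x \<in> ell2_n n" "T x \<in> ell2_n n"
        using that(2,3) N(2)[OF that(3)] ell2_n_mono[of p n] ell2_n_mono[of "p + N" n] by auto
    qed
    obtain L where L': "\<forall>n\<in>{1..}. norm (onorm_on (ell2_n n) (Tn n)) \<le> L"
      using bdd unfolding bounded_iff by auto
    have L: "onorm_on (ell2_n n) (Tn n) \<le> L" if "n \<ge> 1" for n
      using bspec[OF L', of n] that by simp
    have bound: "norm (Tn n x) \<le> L * norm x" if "n \<ge> 1" "x \<in> ell2_n n" for n x
      using norm_le_onorm_on[OF op[OF that(1)] that(2)] mult_right_mono[OF L[OF that(1)], of "norm x"]
      by simp
    show ?thesis
    proof (intro conjI allI subsetI CollectI)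
      fix x
      show "(\<lambda>n. extend_zero (ell2_n n) (Tn n) x) \<longlonglongrightarrow> T x"
        unfolding extend_zero_ell2_n by (rule truncations_tendsto[OF T bound op eq])
    next
      fix z
      assume "z \<in> spectrum_on UNIV T"
      then show "(\<lambda>n. infdist z (spectrum_on (ell2_n n) (Tn n))) \<longlonglongrightarrow> 0"
        by (rule truncations_infdist_tendsto_0[OF assms(1) _ normal eq])
    qed
  qed
  moreover have "ess_spectrum_on (orth_compl (ell2_n n)) A = ess_spectrum_on UNIV T"
    if trunc: "normal_truncation_on (orth_compl (ell2_n n)) T A" for n and A :: "ell2 \<Rightarrow> ell2"
    unfolding orth_compl_ell2_n
  proof (rule ess_spectrum_truncation[OF assms(1), where N = N])
    show "normal_op_on (tail_space n) A"
      using trunc by (simp add: normal_truncation_on_def orth_compl_ell2_n)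
    have tr: "truncation_on (tail_space n) T A"
      using trunc by (simp add: normal_truncation_on_def orth_compl_ell2_n)
    show "A x = T x" if "x \<in> tail_space (n + N)" for x
      using truncation_on_eq[OF tr] N(1)[OF that] that tail_space_antimono[of n "n + N"] by auto
  qed
  ultimately show ?thesis
    by blast
qed

end
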